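(* Let $m\ge3$ be odd, let $k\ge2$, and let $G$ be a $k$-uniform hypergraph with vertex set $V(G)=C_1\sqcup\dots\sqcup C_m\sqcup D$, where $C_i=\{v_{2i-1},v_{2i}\}$ for $i=1,\dots,m$. Indices of the sets $C_i$ are read cyclically modulo $m$, and indices of the vertices $v_j$ cyclically modulo $2m$. Let $\pi(v_j)=v_{j-2}$ for $j=1,\dots,2m$. Assume that: 1. Every $(k-1)$-subset of $D$ has the same number of neighbours in $C_1,\dots,C_m$ modulo $2$. 2. For each $A\in\binom{D}{k-2}$ and for all $i\in\{1,\dots,m\}$ and $j$ with $i<j\le i+\frac{m-1}{2}$, the edge set of the link $G[C_i\cup C_j;A]$ is: - $\emptyset$ or $\{\{y,x\}:y\in C_i,\ x\in C_j\}$ (empty or complete bipartite), if $j<i+\frac{m-1}{2}$; - $\{\{v_{2i-1},x\}:x\in C_j\}$ or $\{\{v_{2i},x\}:x\in C_j\}$, if $j=i+\frac{m-1}{2}$. To construct a hypergraph $H$ on $V(G)$ from $G$: 1. For every $A\in\binom{D}{k-1}$ such that $A$ has exactly one neighbour $v_{s_i}\in C_i$ ($s_i\in\{2i-1,2i\}$) for each $i$, remove the edges $\{v_{s_i}\}\cup A$ and add the edges $\{\pi(v_{s_i})\}\cup A$. 2. For all $A\in\binom{D}{k-2}$ and for each $i=1,\dots,m$, remove the edges of $A\cup C_i\cup C_{i+\frac{m-1}{2}}$ and replace them with those of the induced subgraph on $A\cup C_i\cup C_{i+\frac{m+1}{2}}$; in other words, add the edges $\{A\cup\{v_{2i-2+m},x\}:x\in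 C_i\}$ if $\{A\cup\{v_{2i+m},x\}:x\in C_i\}$ are edges of $G$, or add $\{A\cup\{v_{2i-1+m},x\}:x\in C_i\}$ if $\{A\cup\{v_{2i+m+1},x\}:x\in C_i\}$ are edges of $G$. Then $G$ and $H$ are $E$-cospectral.
   Context: A $k$-uniform hypergraph is a pair $(V,E)$ with $V$ finite and $E\subseteq\binom{V}{k}$. A vertex $x$ is a neighbour of a $(k-1)$-set $A$ of vertices if $\{x\}\cup A\in E(G)$. For $S\subseteq V(G)$ and $A\subseteq V(G)\setminus S$, the link $G[S;A]$ is the hypergraph with vertex set $S$ and edge set $\{f\in\binom{S}{k-|A|}:f\cup A\in E(G)\}$. The hypergraph induced by $S\subseteq V(G)$ has vertex set $S$ and edge set $\{e\in E(G):e\subseteq S\}$. The adjacency tensor $\mathcal{A}_G$ is the order $k$, dimension $n=|V|$ tensor whose $(i_1,\dots,i_k)$ entry is $1$ if $\{i_1,\dots,i_k\}\in E$ and $0$ otherwise. For $x\in\mathbb{C}^n$, $(\mathcal{A}x)_i=\sum_{i_2,\dots,i_k\in[n]}a_{i\,i_2\cdots i_k}x_{i_2}\cdots x_{i_k}$. A number $\lambda\in\mathbb{C}$ is a normalized $E$-eigenvalue of $\mathcal{A}$ if there is $x\in\mathbb{C}^n$ with $\mathcal{A}x=\lambda x$ and $x^\top x=1$. Two $k$-uniform hypergraphs are $E$-cospectral if their adjacency tensors have the same set of normalized $E$-eigenvalues.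
   Formalization: The formal theorem additionally assumes that every edge of G has at most two vertices in C_1 ∪ … ∪ C_m (automatic for k = 2); without this the claim fails, e.g. for k = m = 3, D = {d}, three stars through d plus the extra edge {v_1, v_3, v_4}. *)

theory Defs
  imports Complex_Main "HOL-Library.Ramsey"
begin

datatype 'a hypergraph = Hypergraph (verts: "'a set") (edges: "'a set set")

definition uniform_hypergraph :: "nat \<Rightarrow> 'a hypergraph \<Rightarrow> bool" where
  "uniform_hypergraph k G \<longleftrightarrow> finite (verts G) \<and> edges G \<subseteq> nsets (verts G) k"

definition neighbours :: "'a hypergraph \<Rightarrow> 'a set \<Rightarrow> 'a set" where
  "neighbours G A = {x \<in> verts G. {x} \<union> A \<in> edges G}"

definition link :: "nat \<Rightarrow> 'a hypergraph \<Rightarrow> 'a set \<Rightarrow> 'a set \<Rightarrow> 'a hypergraph" where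
  "link k G S A = Hypergraph S {f \<in> nsets S (k - card A). f \<union> A \<in> edges G}"

definition induced :: "'a hypergraph \<Rightarrow> 'a set \<Rightarrow> 'a hypergraph" where
  "induced G S = Hypergraph S {e \<in> edges G. e \<subseteq> S}"

text \<open>
  Tensors of order \<open>k\<close> are indexed directly by the vertices: an entry is addressed by a list
  of length \<open>k\<close> over the vertex set \<open>V\<close>, and only the values of a vector on \<open>V\<close> matter.
\<close>

definition adjacency_tensor :: "'a hypergraph \<Rightarrow> 'a list \<Rightarrow> complex" where
  "adjacency_tensor G is = (if set is \<in> edges G then 1 else 0)"

definition tensor_apply ::
  "'a set \<Rightarrow> nat \<Rightarrow> ('a list \<Rightarrow> complex) \<Rightarrow> ('a \<Rightarrow> complex) \<Rightarrow> 'a \<Rightarrow> complex" where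
  "tensor_apply V k T x i =
     (\<Sum>js | set js \<subseteq> V \<and> length js = k - 1. T (i # js) * (\<Prod>j\<leftarrow>js. x j))"

text \<open>The normalization is bilinear, not Hermitian: no complex conjugate occurs.\<close>

definition normalized_E_eigenvalue ::
  "'a set \<Rightarrow> nat \<Rightarrow> ('a list \<Rightarrow> complex) \<Rightarrow> complex \<Rightarrow> bool" where
  "normalized_E_eigenvalue V k T \<mu> \<longleftrightarrow>
     (\<exists>x. (\<forall>i\<in>V. tensor_apply V k T x i = \<mu> * x i) \<and> (\<Sum>i\<in>V. x i ^ 2) = 1)"

definition E_cospectral :: "nat \<Rightarrow> 'a hypergraph \<Rightarrow> 'a hypergraph \<Rightarrow> bool" where
  "E_cospectral k G H \<longleftrightarrow> uniform_hypergraph k G \<and> uniform_hypergraph k H \<and>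
     {\<mu>. normalized_E_eigenvalue (verts G) k (adjacency_tensor G) \<mu>} =
     {\<mu>. normalized_E_eigenvalue (verts H) k (adjacency_tensor H) \<mu>}"

text \<open>
  The labelling \<open>v\<close> of the vertices outside \<open>D\<close> is taken to be \<open>2 * m\<close>-periodic on the integers,
  so that the cells \<open>C\<^sub>i\<close> are \<open>m\<close>-periodic in \<open>i\<close> and no index has to be reduced.
\<close>

definition cell :: "(int \<Rightarrow> 'a) \<Rightarrow> int \<Rightarrow> 'a set" where
  "cell v i = {v (2 * i - 1), v (2 * i)}"

text \<open>
  The edges removed and added by the two switching steps are all computed from \<open>G\<close>;
  the steps are carried out simultaneously. If every edge has at most two vertices outside \<open>D\<close>,
  the edges of \<open>G\<close> induced on \<open>A \<union> C\<^sub>i \<union> C\<^sub>j\<close> with \<open>A\<close> a \<open>(k - 2)\<close>-subset of \<open>D\<close> are exactly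
  the sets \<open>A \<union> f\<close> with \<open>f\<close> an edge of the link of \<open>A\<close> in \<open>C\<^sub>i \<union> C\<^sub>j\<close>. Otherwise there can be
  induced edges that do not contain \<open>A\<close>, and \<open>G\<close> and the switched hypergraph need not be
  E-cospectral.
\<close>

definition one_per_cell ::
  "nat \<Rightarrow> int \<Rightarrow> (int \<Rightarrow> 'a) \<Rightarrow> 'a set \<Rightarrow> 'a hypergraph \<Rightarrow> 'a set set" where
  "one_per_cell k m v D G =
     {A \<in> nsets D (k - 1). \<forall>i\<in>{1..m}. card (neighbours G A \<inter> cell v i) = 1}"

definition removed1 ::
  "nat \<Rightarrow> int \<Rightarrow> (int \<Rightarrow> 'a) \<Rightarrow> 'a set \<Rightarrow> 'a hypergraph \<Rightarrow> 'a set set" where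
  "removed1 k m v D G =
     {{x} \<union> A | x A i. A \<in> one_per_cell k m v D G \<and> i \<in> {1..m} \<and> x \<in> neighbours G A \<inter> cell v i}"

definition added1 ::
  "nat \<Rightarrow> int \<Rightarrow> (int \<Rightarrow> 'a) \<Rightarrow> 'a set \<Rightarrow> ('a \<Rightarrow> 'a) \<Rightarrow> 'a hypergraph \<Rightarrow> 'a set set" where
  "added1 k m v D \<pi> G =
     {{\<pi> x} \<union> A | x A i. A \<in> one_per_cell k m v D G \<and> i \<in> {1..m} \<and> x \<in> neighbours G A \<inter> cell v i}"

definition removed2 ::
  "nat \<Rightarrow> int \<Rightarrow> (int \<Rightarrow> 'a) \<Rightarrow> 'a set \<Rightarrow> 'a hypergraph \<Rightarrow> 'a set set" where
  "removed2 k m v D G =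
     (\<Union>A \<in> nsets D (k - 2). \<Union>i \<in> {1..m}.
        edges (induced G (A \<union> cell v i \<union> cell v (i + (m - 1) div 2))))"

text \<open>
  For \<open>j = i + (m + 1) div 2\<close> the vertices \<open>v (2 * i + m)\<close> and \<open>v (2 * i + m + 1)\<close> are the two
  elements of \<open>cell v j\<close>; the new centres are their images under \<open>\<pi>\<close>, in \<open>cell v (j - 1)\<close>.
\<close>

definition added2 ::
  "nat \<Rightarrow> int \<Rightarrow> (int \<Rightarrow> 'a) \<Rightarrow> 'a set \<Rightarrow> 'a hypergraph \<Rightarrow> 'a set set" where
  "added2 k m v D G =
     (\<Union>A \<in> nsets D (k - 2). \<Union>i \<in> {1..m}.
        (if {A \<union> {v (2 * i + m), x} | x. x \<in> cell v i} \<subseteq> edges G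
         then {A \<union> {v (2 * i - 2 + m), x} | x. x \<in> cell v i} else {}) \<union>
        (if {A \<union> {v (2 * i + m + 1), x} | x. x \<in> cell v i} \<subseteq> edges G
         then {A \<union> {v (2 * i - 1 + m), x} | x. x \<in> cell v i} else {}))"

definition switched ::
  "nat \<Rightarrow> int \<Rightarrow> (int \<Rightarrow> 'a) \<Rightarrow> 'a set \<Rightarrow> ('a \<Rightarrow> 'a) \<Rightarrow> 'a hypergraph \<Rightarrow> 'a hypergraph" where
  "switched k m v D \<pi> G = Hypergraph (verts G)
     ((edges G - (removed1 k m v D G \<union> removed2 k m v D G))
      \<union> (added1 k m v D \<pi> G \<union> added2 k m v D G))"

end

theory Submission
  imports Defs "HOL-Combinatorics.Multiset_Permutations"
begin

text \<open>
  The adjacency tensor is, up to a factor, the gradient of the form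
  \<open>f\<^sub>G(x) = \<Sum>\<^sub>e \<Prod>\<^sub>w\<^sub>\<in>\<^sub>e x\<^sub>w\<close>. Hence \<open>G\<close> and \<open>H\<close> are E-cospectral as soon as \<open>f\<^sub>H(x) = f\<^sub>G(Q x)\<close>
  for an orthogonal matrix \<open>Q\<close>. Describe a vector on the cell \<open>C\<^sub>i\<close> by the sum \<open>s\<^sub>i\<close> and the difference
  \<open>d\<^sub>i\<close> of its two entries; \<open>Q\<close> keeps every \<open>s\<^sub>i\<close> and all entries on \<open>D\<close>, and replaces \<open>d\<^sub>i\<close> by
  \<open>d\<^sub>i\<^sub>-\<^sub>1\<close>.

  Sort the edges by their trace \<open>A\<close> on \<open>D\<close>; what remains outside \<open>D\<close> is a constant, a linear or a
  quadratic form. If \<open>A\<close> has an even number of neighbours in each cell, its linear form is a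
  combination of the \<open>s\<^sub>i\<close> and hence invariant; with one neighbour in each cell, \<open>Q\<close> moves
  \<open>(s\<^sub>i \<plusminus> d\<^sub>i)/2\<close> to \<open>(s\<^sub>i \<plusminus> d\<^sub>i\<^sub>-\<^sub>1)/2\<close>, which is the effect of \<open>\<pi>\<close> after summation over \<open>i\<close>. In the
  quadratic form a complete bipartite link contributes the invariant \<open>s\<^sub>i s\<^sub>j\<close>. With \<open>m = 2 h + 1\<close>, the
  stars contribute \<open>\<Sum>\<^sub>i (s\<^sub>i \<plusminus> d\<^sub>i) s\<^sub>i\<^sub>+\<^sub>h / 2\<close>, where \<open>Q\<close> turns \<open>d\<^sub>i\<close> into \<open>d\<^sub>i\<^sub>-\<^sub>1\<close>; since \<open>i + h\<close> and
  \<open>(i - 1) - h\<close> agree modulo \<open>m\<close>, the result is the sum of stars centred in \<open>C\<^sub>i\<^sub>-\<^sub>1\<close> with leaves in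
  \<open>C\<^bsub>(i-1)-h\<^esub>\<close>, as in \<open>H\<close>.
\<close>

section \<open>Orthogonal substitutions in the edge form\<close>

definition edge_form :: "'a set set \<Rightarrow> ('a \<Rightarrow> complex) \<Rightarrow> complex" where
  "edge_form E x = (\<Sum>e\<in>E. \<Prod>w\<in>e. x w)"

lemma uniform_hypergraph_edgeD:
  assumes "uniform_hypergraph k G" "e \<in> edges G"
  shows "e \<subseteq> verts G" "finite e" "card e = k"
  using assms by (auto simp: uniform_hypergraph_def nsets_def)

lemma uniform_hypergraph_finite_edges:
  assumes "uniform_hypergraph k G"
  shows "finite (edges G)"
  using assms finite_subset[OF _ finite_imp_finite_nsets]
  by (auto simp: uniform_hypergraph_def)

text \<open>An edge has \<open>k\<close> elements, so a list \<open>i # js\<close> of length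
  \<open>k\<close> whose set is an edge has no repetition. The terms with nonzero tensor entry
  therefore run over the (k-1)! orderings of each \<open>e - {i}\<close>, all with the same
  product.\<close>

lemma tensor_apply_adjacency_tensor:
  assumes G: "uniform_hypergraph k G" and k: "k \<ge> 1"
  shows "tensor_apply (verts G) k (adjacency_tensor G) x i =
    fact (k - 1) * (\<Sum>e | e \<in> edges G \<and> i \<in> e. \<Prod>w\<in>e - {i}. x w)"
proof -
  let ?E = "{e \<in> edges G. i \<in> e}"
  let ?L = "{js. set js \<subseteq> verts G \<and> length js = k - 1}"
  have finV: "finite (verts G)"
    using G by (simp add: uniform_hypergraph_def)
  have finE: "finite ?E"
    using uniform_hypergraph_finite_edges[OF G] by simp
  have finL: "finite ?L"
    using finite_lists_length_eq[OF finV] .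
  have lists: "{js \<in> ?L. set (i # js) \<in> edges G} = (\<Union>e\<in>?E. permutations_of_set (e - {i}))"
    (is "?A = ?B")
  proof (intro equalityI subsetI)
    fix js assume js: "js \<in> ?A"
    then have e: "insert i (set js) \<in> edges G" and len: "length js = k - 1"
      by auto
    have c: "card (insert i (set js)) = k"
      using uniform_hypergraph_edgeD(3)[OF G e] .
    have "i \<notin> set js"
    proof
      assume "i \<in> set js"
      then have "card (set js) = k"
        using c by (simp add: insert_absorb)
      then show False
        using card_length[of js] len k by linarith
    qed
    moreover from this have "distinct js"
      using c len by (intro card_distinct) simp
    ultimately have "js \<in> permutations_of_set (insert i (set js) - {i})"
      by (intro permutations_of_setI) auto
    then show "js \<in> ?B"
      using e by blast
  next
    fix js assume "js \<in> ?B"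
    then obtain e where e: "e \<in> edges G" "i \<in> e" "js \<in> permutations_of_set (e - {i})"
      by blast
    note edge = uniform_hypergraph_edgeD[OF G e(1)]
    have "set js = e - {i}" "distinct js"
      using permutations_of_setD[OF e(3)] by simp_all
    moreover from this have "length js = k - 1"
      using distinct_card[of js] edge e(2) by simp
    ultimately show "js \<in> ?A"
      using e edge by (auto simp: insert_absorb)
  qed
  have "tensor_apply (verts G) k (adjacency_tensor G) x i =
      (\<Sum>js\<in>?L. if set (i # js) \<in> edges G then \<Prod>j\<leftarrow>js. x j else 0)"
    unfolding tensor_apply_def adjacency_tensor_def by (intro sum.cong) auto
  also have "\<dots> = (\<Sum>js\<in>{js \<in> ?L. set (i # js) \<in> edges G}. \<Prod>j\<leftarrow>js. x j)"
    using finL by (rule sum.inter_filter[symmetric])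
  also have "\<dots> = (\<Sum>e\<in>?E. \<Sum>js\<in>permutations_of_set (e - {i}). \<Prod>j\<leftarrow>js. x j)"
    unfolding lists using finE
    by (intro sum.UNION_disjoint) (auto 4 4 dest: permutations_of_setD(1))
  also have "\<dots> = (\<Sum>e\<in>?E. fact (k - 1) * (\<Prod>w\<in>e - {i}. x w))"
  proof (intro sum.cong refl)
    fix e assume e: "e \<in> ?E"
    then have edge: "finite e" "card e = k"
      using uniform_hypergraph_edgeD[OF G] by auto
    have "(\<Sum>js\<in>permutations_of_set (e - {i}). \<Prod>j\<leftarrow>js. x j) =
        (\<Sum>js\<in>permutations_of_set (e - {i}). \<Prod>w\<in>e - {i}. x w)"
      by (intro sum.cong refl)
        (metis permutations_of_setD(1) permutations_of_setD(2) prod.distinct_set_conv_list)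
    then show "(\<Sum>js\<in>permutations_of_set (e - {i}). \<Prod>j\<leftarrow>js. x j) =
        fact (k - 1) * (\<Prod>w\<in>e - {i}. x w)"
      using edge e by simp
  qed
  finally show ?thesis
    by (simp add: sum_distrib_left)
qed

text \<open>The gradient is used only through directional derivatives, so one complex variable
  \<open>t\<close> suffices. The product rule gives a sum over incident pairs of a vertex and an
  edge, which is regrouped by vertices.\<close>

lemma edge_form_has_derivative:
  assumes G: "uniform_hypergraph k G" and k: "k \<ge> 1"
  shows "((\<lambda>t. edge_form (edges G) (\<lambda>w. x w + t * y w)) has_field_derivative
    (\<Sum>i\<in>verts G. y i * tensor_apply (verts G) k (adjacency_tensor G) x i) / fact (k - 1))
    (at 0)"
proof -
  let ?V = "verts G" and ?E = "edges G"
  have fin: "finite ?V" "finite ?E"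
    using G uniform_hypergraph_finite_edges[OF G] by (auto simp: uniform_hypergraph_def)
  have "(\<Sum>e\<in>?E. \<Sum>i\<in>e. y i * (\<Prod>w\<in>e - {i}. x w)) =
      (\<Sum>e\<in>?E. \<Sum>i | i \<in> ?V \<and> i \<in> e. y i * (\<Prod>w\<in>e - {i}. x w))"
    using uniform_hypergraph_edgeD(1)[OF G] by (intro sum.cong) blast+
  also have "\<dots> = (\<Sum>i\<in>?V. \<Sum>e | e \<in> ?E \<and> i \<in> e. y i * (\<Prod>w\<in>e - {i}. x w))"
    using fin by (intro sum.swap_restrict) auto
  also have "\<dots> = (\<Sum>i\<in>?V. y i * tensor_apply ?V k (adjacency_tensor G) x i) / fact (k - 1)"
    unfolding tensor_apply_adjacency_tensor[OF G k] sum_divide_distrib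
    by (intro sum.cong refl)
      (simp add: sum_distrib_left[symmetric] mult.left_commute[of _ "fact _"])
  finally have eq: "(\<Sum>i\<in>?V. y i * tensor_apply ?V k (adjacency_tensor G) x i) / fact (k - 1) =
      (\<Sum>e\<in>?E. \<Sum>i\<in>e. y i * (\<Prod>w\<in>e - {i}. x w))"
    by simp
  have "((\<lambda>t. \<Prod>w\<in>e. x w + t * y w) has_field_derivative
      (\<Sum>i\<in>e. y i * (\<Prod>w\<in>e - {i}. x w + 0 * y w))) (at 0)" for e
    by (intro has_field_derivative_prod) (auto intro!: derivative_eq_intros)
  then show ?thesis
    unfolding eq edge_form_def by (intro DERIV_sum) simp
qed

text \<open>Differentiating \<open>f\<^sub>H(x) = f\<^sub>G(Q x)\<close> in direction \<open>y\<close> gives \<open>y\<^sup>T (\<A>\<^sub>H x) = (Q y)\<^sup>T (\<A>\<^sub>G (Q x))\<close>.\<close>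

lemma normalized_E_eigenvalue_transfer:
  fixes Q R :: "('a \<Rightarrow> complex) \<Rightarrow> 'a \<Rightarrow> complex"
  assumes G: "uniform_hypergraph k G" and H: "uniform_hypergraph k H" and k: "k \<ge> 1"
    and verts: "verts H = verts G"
    and linear: "\<And>x y t w. Q (\<lambda>u. x u + t * y u) w = Q x w + t * Q y w"
    and isometry: "\<And>x y. (\<Sum>w\<in>verts G. Q x w * Q y w) = (\<Sum>w\<in>verts G. x w * y w)"
    and inverse: "\<And>x w. w \<in> verts G \<Longrightarrow> Q (R x) w = x w"
    and form: "\<And>x. edge_form (edges H) x = edge_form (edges G) (Q x)"
    and \<mu>: "normalized_E_eigenvalue (verts G) k (adjacency_tensor G) \<mu>"
  shows "normalized_E_eigenvalue (verts H) k (adjacency_tensor H) \<mu>"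
proof -
  let ?V = "verts G"
  let ?TG = "tensor_apply ?V k (adjacency_tensor G)"
  let ?TH = "tensor_apply ?V k (adjacency_tensor H)"
  have fin: "finite ?V"
    using G by (simp add: uniform_hypergraph_def)
  obtain z where z: "\<And>i. i \<in> ?V \<Longrightarrow> ?TG z i = \<mu> * z i" "(\<Sum>i\<in>?V. z i ^ 2) = 1"
    using \<mu> unfolding normalized_E_eigenvalue_def by blast
  \<comment> \<open>The eigenvector of \<open>G\<close> is pulled back, so that \<open>Q x\<close>
    agrees with \<open>z\<close> on the vertices.\<close>
  define x where "x = R z"
  have Qx: "Q x w = z w" if "w \<in> ?V" for w
    using inverse[OF that] by (simp add: x_def)
  have TG_cong: "?TG (Q x) i = ?TG z i" for i
    unfolding tensor_apply_def using Qx
    by (intro sum.cong refl arg_cong2[of _ _ _ _ "(*)"] arg_cong[of _ _ prod_list] map_cong) auto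
  have bilinear: "(\<Sum>i\<in>?V. y i * ?TH x i) = (\<Sum>i\<in>?V. Q y i * ?TG (Q x) i)" for y
  proof -
    have "((\<lambda>t. edge_form (edges G) (\<lambda>w. Q x w + t * Q y w)) has_field_derivative
        (\<Sum>i\<in>?V. y i * ?TH x i) / fact (k - 1)) (at 0)"
      using edge_form_has_derivative[OF H k, of x y] by (simp add: form linear[abs_def] verts)
    from DERIV_unique[OF this edge_form_has_derivative[OF G k]] show ?thesis
      by simp
  qed
  have "?TH x i = \<mu> * x i" if i: "i \<in> ?V" for i
  proof -
    \<comment> \<open>Testing the bilinear identity against a unit vector isolates one coordinate;
      the isometry then turns the pairing of \<open>Q ?e\<close> with \<open>Q x\<close> back into
      that of \<open>?e\<close> with \<open>x\<close>.\<close>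
    let ?e = "\<lambda>w. if w = i then 1 else 0 :: complex"
    have delta: "(\<Sum>w\<in>?V. ?e w * F w) = F i" for F
    proof -
      have "(\<Sum>w\<in>?V. ?e w * F w) = (\<Sum>w\<in>?V. if w = i then F w else 0)"
        by (intro sum.cong) auto
      then show ?thesis
        using i fin by simp
    qed
    have "?TH x i = (\<Sum>w\<in>?V. ?e w * ?TH x w)"
      by (rule delta[symmetric])
    also have "\<dots> = (\<Sum>w\<in>?V. \<mu> * (Q ?e w * Q x w))"
      unfolding bilinear TG_cong using z(1) Qx by (intro sum.cong) auto
    also have "\<dots> = \<mu> * (\<Sum>w\<in>?V. ?e w * x w)"
      by (simp only: sum_distrib_left[symmetric] isometry)
    also have "\<dots> = \<mu> * x i"
      by (simp only: delta)
    finally show ?thesis .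
  qed
  moreover have "(\<Sum>i\<in>?V. x i ^ 2) = (\<Sum>i\<in>?V. z i ^ 2)"
    using isometry[of x x] Qx by (simp add: power2_eq_square)
  ultimately show ?thesis
    unfolding normalized_E_eigenvalue_def verts using z(2) by auto
qed

lemma edge_form_cong:
  assumes "\<Union>E \<subseteq> V" "\<And>w. w \<in> V \<Longrightarrow> x w = y w"
  shows "edge_form E x = edge_form E y"
  unfolding edge_form_def using assms by (intro sum.cong prod.cong) auto

text \<open>Transfer along \<open>Q\<close> gives one inclusion of spectra. For the other,
  substituting \<open>R x\<close> into the form identity shows that \<open>R\<close> does the same
  with \<open>G\<close> and \<open>H\<close> exchanged.\<close>

lemma E_cospectral_if_orthogonal_substitution:
  fixes Q R :: "('a \<Rightarrow> complex) \<Rightarrow> 'a \<Rightarrow> complex"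
  assumes G: "uniform_hypergraph k G" and H: "uniform_hypergraph k H" and k: "k \<ge> 1"
    and verts: "verts H = verts G"
    and linear: "\<And>x y t w. Q (\<lambda>u. x u + t * y u) w = Q x w + t * Q y w"
      "\<And>x y t w. R (\<lambda>u. x u + t * y u) w = R x w + t * R y w"
    and isometry: "\<And>x y. (\<Sum>w\<in>verts G. Q x w * Q y w) = (\<Sum>w\<in>verts G. x w * y w)"
      "\<And>x y. (\<Sum>w\<in>verts G. R x w * R y w) = (\<Sum>w\<in>verts G. x w * y w)"
    and inverse: "\<And>x w. w \<in> verts G \<Longrightarrow> Q (R x) w = x w"
      "\<And>x w. w \<in> verts G \<Longrightarrow> R (Q x) w = x w"
    and form: "\<And>x. edge_form (edges H) x = edge_form (edges G) (Q x)"
  shows "E_cospectral k G H"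
proof -
  have form': "edge_form (edges G) x = edge_form (edges H) (R x)" for x
    unfolding form using uniform_hypergraph_edgeD(1)[OF G] inverse(1)
    by (intro edge_form_cong[of _ "verts G"]) auto
  show ?thesis
    unfolding E_cospectral_def
    using G H normalized_E_eigenvalue_transfer[OF G H k verts linear(1) isometry(1) inverse(1) form]
      normalized_E_eigenvalue_transfer[OF H G k verts[symmetric] linear(2), unfolded verts,
        OF isometry(2) inverse(2) form'] verts by auto
qed

section \<open>Cyclically arranged pairs of vertices\<close>

lemma periodic_mult:
  fixes f :: "int \<Rightarrow> 'b"
  assumes "\<And>i. f (i + p) = f i"
  shows "f (i + q * p) = f i"
proof (induction q arbitrary: i rule: int_induct[where k = 0])
  case (step1 q)
  then show ?case
    using assms[of "i + q * p"] by (simp add: algebra_simps)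
next
  case (step2 q)
  then show ?case
    using assms[of "i + (q - 1) * p"] by (simp add: algebra_simps)
qed simp

text \<open>Disjointness makes the unordered pairs correspond to the elements of
  \<open>S \<times> T\<close> and splits each product into two factors. Besides complete bipartite
  links this covers stars, where \<open>S\<close> is a singleton.\<close>

lemma sum_prod_complete_bipartite:
  fixes x :: "'a \<Rightarrow> 'b::comm_semiring_1"
  assumes "finite S" "finite T" "S \<inter> T = {}"
  shows "(\<Sum>B\<in>{{a, b} | a b. a \<in> S \<and> b \<in> T}. \<Prod>w\<in>B. x w) = sum x S * sum x T"
proof -
  have "(\<Sum>B\<in>{{a, b} | a b. a \<in> S \<and> b \<in> T}. \<Prod>w\<in>B. x w) =
      (\<Sum>B\<in>(\<lambda>(a, b). {a, b}) ` (S \<times> T). \<Prod>w\<in>B. x w)"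
    by (rule arg_cong[of _ _ "sum _"]) auto
  also have "\<dots> = (\<Sum>p\<in>S \<times> T. \<Prod>w\<in>(case p of (a, b) \<Rightarrow> {a, b}). x w)"
    using assms(3) by (subst sum.reindex) (auto simp: inj_on_def doubleton_eq_iff)
  also have "\<dots> = (\<Sum>(a, b)\<in>S \<times> T. x a * x b)"
  proof (intro sum.cong refl)
    fix p assume "p \<in> S \<times> T"
    then obtain a b where p: "p = (a, b)" "a \<in> S" "b \<in> T"
      by auto
    then have "a \<noteq> b"
      using assms(3) by blast
    with p show "(\<Prod>w\<in>(case p of (a, b) \<Rightarrow> {a, b}). x w) = (case p of (a, b) \<Rightarrow> x a * x b)"
      by simp
  qed
  also have "\<dots> = sum x S * sum x T"
    by (simp add: sum_product sum.cartesian_product)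
  finally show ?thesis .
qed

text \<open>Carrying \<open>h\<close> as a parameter keeps parity and division out of the arguments;
  it is the largest cyclic distance between two cells.\<close>

locale cyclic_cells =
  fixes m h :: int and v :: "int \<Rightarrow> 'a" and D :: "'a set"
  assumes m_eq: "m = 2 * h + 1" and h_pos: "h \<ge> 1"
    and periodic: "v (j + 2 * m) = v j"
    and inj: "inj_on v {1..2 * m}"
    and disjoint: "(\<Union>i\<in>{1..m}. cell v i) \<inter> D = {}"
    and finite_D: "finite D"
begin

section \<open>Indices modulo the period\<close>

lemma m_pos: "m > 0"
  using m_eq h_pos by simp

lemma dvd_small_eq_0: "m dvd a \<Longrightarrow> \<bar>a\<bar> < m \<Longrightarrow> a = 0"
  using dvd_imp_le_int[of a m] by auto

definition C :: "'a set" where "C = (\<Union>i\<in>{1..m}. cell v i)"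

lemma period_representative:
  fixes i :: int
  obtains i0 q where "i0 \<in> {1..m}" "i = i0 + q * m"
proof
  show "(i - 1) mod m + 1 \<in> {1..m}"
    using m_pos pos_mod_bound[of m "i - 1"] pos_mod_sign[of m "i - 1"]
    unfolding atLeastAtMost_iff by linarith
  show "i = (i - 1) mod m + 1 + (i - 1) div m * m"
    using div_mult_mod_eq[of "i - 1" m] by linarith
qed

text \<open>Both indices are reduced to representatives in \<open>{1..2 * m}\<close>, where
  \<open>v\<close> is injective.\<close>

lemma v_eq_iff: "v a = v b \<longleftrightarrow> 2 * m dvd a - b"
proof -
  have red: "v a = v ((a - 1) mod (2 * m) + 1)" for a
    using periodic_mult[of v "2 * m", OF periodic, of "(a - 1) mod (2 * m) + 1" "(a - 1) div (2 * m)"]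
      div_mult_mod_eq[of "a - 1" "2 * m"] by (simp add: algebra_simps)
  have range: "(a - 1) mod (2 * m) + 1 \<in> {1..2 * m}" for a
    using m_pos pos_mod_bound[of "2 * m" "a - 1"] pos_mod_sign[of "2 * m" "a - 1"]
    unfolding atLeastAtMost_iff by linarith
  have "v a = v b \<longleftrightarrow> (a - 1) mod (2 * m) + 1 = (b - 1) mod (2 * m) + 1"
    using inj_on_eq_iff[OF inj range range, of a b] by (simp add: red[symmetric])
  then show ?thesis
    by (simp add: mod_eq_dvd_iff)
qed

lemma cell_periodic: "cell v (i + m) = cell v i"
  using periodic[of "2 * i"] periodic[of "2 * i - 1"] by (simp add: cell_def algebra_simps)

lemma cell_periodic_mult: "cell v (i + q * m) = cell v i"
  by (rule periodic_mult[of "cell v" m, OF cell_periodic])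

lemma v_Suc_neq: "v (2 * i - 1) \<noteq> v (2 * i)"
  using m_pos v_eq_iff[of "2 * i - 1" "2 * i"] by simp

lemma cell_subset_C: "cell v i \<subseteq> C"
proof -
  obtain i0 q where "i0 \<in> {1..m}" "i = i0 + q * m"
    by (rule period_representative)
  then show ?thesis
    using cell_periodic_mult[of i0 q] by (auto simp: C_def)
qed

lemma v_in_C: "v j \<in> C"
proof (cases "even j")
  case True
  then have "v j \<in> cell v (j div 2)"
    by (simp add: cell_def)
  then show ?thesis
    using cell_subset_C by blast
next
  case False
  then have "v j \<in> cell v ((j + 1) div 2)"
    by (auto simp: cell_def add.commute elim!: oddE)
  then show ?thesis
    using cell_subset_C by blast
qed

lemma C_cases:
  assumes "w \<in> C"
  obtains i j where "i \<in> {1..m}" "j \<in> {2 * i - 1, 2 * i}" "w = v j"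
  using assms unfolding C_def cell_def by blast

lemma finite_C: "finite C"
  by (simp add: C_def cell_def)

lemma C_disjoint_D: "C \<inter> D = {}"
  using disjoint by (simp add: C_def)

lemma finite_cell: "finite (cell v i)"
  by (simp add: cell_def)

lemma cells_meetD:
  assumes "w \<in> cell v i" "w \<in> cell v j"
  shows "m dvd i - j"
proof -
  obtain a b where ab: "a \<in> {0, 1}" "b \<in> {0, 1}" "w = v (2 * i - a)" "w = v (2 * j - b)"
    using assms unfolding cell_def by (metis diff_zero insert_iff singletonD)
  then obtain t where t: "2 * i - a - (2 * j - b) = 2 * m * t"
    using v_eq_iff[of "2 * i - a" "2 * j - b"] by (auto elim: dvdE)
  \<comment> \<open>Hiding the product \<open>m * t\<close> behind \<open>n\<close> leaves a linear
    equation; parity then forces \<open>a = b\<close>.\<close>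
  define n where "n = m * t"
  have "2 * i - a - (2 * j - b) = 2 * n"
    using t by (simp add: n_def)
  then have "i - j = n"
    using ab(1,2) by auto
  then show ?thesis
    by (simp add: n_def)
qed

lemma cells_disjoint: "\<not> m dvd i - j \<Longrightarrow> cell v i \<inter> cell v j = {}"
  using cells_meetD by blast

lemma cells_disjoint_offset:
  assumes "0 < r" "r \<le> h"
  shows "cell v i \<inter> cell v (i + r) = {}"
  using cells_disjoint[of i "i + r"] dvd_small_eq_0[of r] assms m_eq by auto

lemma sum_cell: "sum F (cell v i) = F (v (2 * i - 1)) + F (v (2 * i))"
  using v_Suc_neq[of i] by (simp add: cell_def)

lemma sum_C:
  fixes F :: "'a \<Rightarrow> 'b::comm_monoid_add"
  shows "sum F C = (\<Sum>i\<in>{1..m}. sum F (cell v i))"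
  unfolding C_def
proof (rule sum.UNION_disjoint)
  show "\<forall>i\<in>{1..m}. \<forall>j\<in>{1..m}. i \<noteq> j \<longrightarrow> cell v i \<inter> cell v j = {}"
  proof (intro ballI impI)
    fix i j assume "i \<in> {1..m}" "j \<in> {1..m}" "i \<noteq> j"
    then have "\<bar>i - j\<bar> < m" "i - j \<noteq> 0"
      by auto
    then have "\<not> m dvd i - j"
      using dvd_small_eq_0 by blast
    then show "cell v i \<inter> cell v j = {}"
      by (rule cells_disjoint)
  qed
qed (auto simp: finite_cell)

lemma sum_C_filter:
  fixes F :: "'a \<Rightarrow> 'b::comm_monoid_add"
  shows "sum F (C \<inter> N) = (\<Sum>i\<in>{1..m}. sum F (cell v i \<inter> N))"
  using sum_C[of "\<lambda>w. if w \<in> N then F w else 0"]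
  by (simp add: sum.If_cases finite_C finite_cell)

text \<open>This is the reindexing behind every cyclic cancellation below. Moving the window by one
  trades the term at \<open>1\<close> for the equal term at \<open>m + 1\<close>; induction in both
  directions covers every \<open>c\<close>.\<close>

lemma sum_shift:
  fixes F :: "int \<Rightarrow> 'b::comm_monoid_add"
  assumes F: "\<And>i. F (i + m) = F i"
  shows "(\<Sum>i\<in>{1..m}. F (i + c)) = sum F {1..m}"
proof -
  have step: "(\<Sum>i\<in>{1..m}. F (i + 1 + c)) = (\<Sum>i\<in>{1..m}. F (i + c))" for c
  proof -
    have "(\<Sum>i\<in>{1..m}. F (i + 1 + c)) = (\<Sum>i\<in>{2..m + 1}. F (i + c))"
      by (rule sum.reindex_bij_witness[of _ "\<lambda>i. i - 1" "\<lambda>i. i + 1"]) auto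
    also have "{2..m + 1} = insert (m + 1) {2..m}"
      using m_pos by auto
    also have "(\<Sum>i\<in>insert (m + 1) {2..m}. F (i + c)) = F (1 + c) + (\<Sum>i\<in>{2..m}. F (i + c))"
      using F[of "1 + c"] by (simp add: algebra_simps)
    also have "\<dots> = (\<Sum>i\<in>insert 1 {2..m}. F (i + c))"
      by simp
    also have "insert 1 {2..m} = {1..m}"
      using m_pos by auto
    finally show ?thesis .
  qed
  show ?thesis
  proof (induction c rule: int_induct[where k = 0])
    case (step1 c)
    then show ?case
      using step[of c] by (simp add: algebra_simps)
  next
    case (step2 c)
    then show ?case
      using step[of "c - 1"] by (simp add: algebra_simps)
  qed simp
qed

section \<open>Pairs of vertices from different cells\<close>

lemma cross_pair_unique:
  assumes B: "B \<subseteq> cell v i \<union> cell v (i + r)" "B \<subseteq> cell v i' \<union> cell v (i' + r')"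
    and cross: "\<And>j. \<not> B \<subseteq> cell v j"
    and r: "r \<in> {1..h}" "r' \<in> {1..h}"
  shows "m dvd i - i'" "r = r'"
proof -
  obtain y where y: "y \<in> B" "y \<in> cell v i"
    using B(1) cross[of "i + r"] by blast
  obtain x where x: "x \<in> B" "x \<in> cell v (i + r)"
    using B(1) cross[of i] by blast
  have small: "\<not> m dvd a" if "\<bar>a\<bar> < m" "a \<noteq> 0" for a
    using dvd_small_eq_0 that by blast
  have cy: "m dvd i - i' \<or> m dvd i - (i' + r')" and cx: "m dvd i + r - i' \<or> m dvd i + r - (i' + r')"
    using B(2) x y cells_meetD by blast+
  have no: "\<not> m dvd r" "\<not> m dvd r + r'"
    using small[of r] small[of "r + r'"] r m_eq by auto
  \<comment> \<open>\<open>y\<close> and \<open>x\<close> lie in the cells \<open>i\<close> and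
    \<open>i + r\<close>, and each also in one of the cells \<open>i'\<close> and
    \<open>i' + r'\<close>. Cases 1 and 2 send both to the same cell, so \<open>m\<close> would
    divide \<open>r\<close>; case 3 exchanges the cells, so \<open>m\<close> would divide
    \<open>r + r'\<close>, which lies strictly between \<open>0\<close> and \<open>m\<close>. Hence
    the cells match in order.\<close>
  have 1: "\<not> (m dvd i - i' \<and> m dvd i + r - i')"
    using no(1) dvd_diff[of m "i + r - i'" "i - i'"] by (auto simp: algebra_simps)
  have 2: "\<not> (m dvd i - (i' + r') \<and> m dvd i + r - (i' + r'))"
    using no(1) dvd_diff[of m "i + r - (i' + r')" "i - (i' + r')"] by (auto simp: algebra_simps)
  have 3: "\<not> (m dvd i - (i' + r') \<and> m dvd i + r - i')"
    using no(2) dvd_diff[of m "i + r - i'" "i - (i' + r')"] by (auto simp: algebra_simps)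
  show dvd: "m dvd i - i'"
    using cy cx 2 3 by blast
  then have "m dvd i + r - (i' + r')"
    using cx 1 by blast
  then have "m dvd r - r'"
    using dvd dvd_diff[of m "i + r - (i' + r')" "i - i'"] by (auto simp: algebra_simps)
  then show "r = r'"
    using dvd_small_eq_0[of "r - r'"] r m_eq by auto
qed

lemma cross_pair_exists:
  assumes B: "B \<in> nsets C 2" and cross: "\<And>j. \<not> B \<subseteq> cell v j"
  obtains i r where "i \<in> {1..m}" "r \<in> {1..h}" "B \<subseteq> cell v i \<union> cell v (i + r)"
proof -
  obtain y x where yx: "B = {y, x}"
    using B by (auto simp: nsets_def card_2_iff)
  then obtain a b where ab: "a \<in> {1..m}" "y \<in> cell v a" "b \<in> {1..m}" "x \<in> cell v b"
    using B by (auto simp: nsets_def C_def)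
  then have neq: "a \<noteq> b"
    using cross[of a] yx by auto
  note found = that
  have wlog: thesis if a: "a \<in> {1..m}" and b: "b \<in> {1..m}" and less: "a < b"
    and B: "B \<subseteq> cell v a \<union> cell v b" for a b
  proof (cases "b - a \<le> h")
    case True
    then show thesis
      using found[of a "b - a"] a less B by auto
  next
    case False
    \<comment> \<open>The way around the cycle from \<open>b\<close> to \<open>a + m\<close> has
      length \<open>m - (b - a)\<close>, which is at most \<open>h\<close> because
      \<open>m = 2 * h + 1\<close>.\<close>
    then show thesis
      using found[of b "a + m - b"] a b less B m_eq cell_periodic[of a] by auto
  qed
  show thesis
    using wlog[of a b] wlog[of b a] ab yx neq by fastforce
qed

text \<open>As \<open>m\<close> is odd, exactly one of two distinct cells reaches the other by a
  forward step \<open>r\<close> of length at most \<open>h\<close>. So each pair is counted once, by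
  its starting cell and its step.\<close>

lemma sum_cross_pairs:
  fixes F :: "'a set \<Rightarrow> 'b::comm_monoid_add"
  assumes L: "L \<subseteq> nsets C 2" and cross: "\<And>B j. B \<in> L \<Longrightarrow> \<not> B \<subseteq> cell v j"
  shows "sum F L = (\<Sum>i\<in>{1..m}. \<Sum>r\<in>{1..h}. sum F {B \<in> L. B \<subseteq> cell v i \<union> cell v (i + r)})"
proof -
  let ?I = "{1..m} \<times> {1..h}"
  let ?P = "\<lambda>(i, r). {B \<in> L. B \<subseteq> cell v i \<union> cell v (i + r)}"
  have fin: "finite L"
    using finite_subset[OF L finite_imp_finite_nsets[OF finite_C]] .
  have L_eq: "L = (\<Union>p\<in>?I. ?P p)"
  proof (intro equalityI subsetI)
    fix B assume B: "B \<in> L"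
    then obtain i r where "i \<in> {1..m}" "r \<in> {1..h}" "B \<subseteq> cell v i \<union> cell v (i + r)"
      using cross_pair_exists[of B] L cross by blast
    then show "B \<in> (\<Union>p\<in>?I. ?P p)"
      using B by (intro UN_I[of "(i, r)"]) auto
  qed auto
  have "sum F L = (\<Sum>p\<in>?I. sum F (?P p))"
  proof (subst L_eq, rule sum.UNION_disjoint)
    show "\<forall>p\<in>?I. \<forall>q\<in>?I. p \<noteq> q \<longrightarrow> ?P p \<inter> ?P q = {}"
    proof (intro ballI impI, rule ccontr)
      fix p q assume pq: "p \<in> ?I" "q \<in> ?I" "p \<noteq> q" "?P p \<inter> ?P q \<noteq> {}"
      obtain i r i' r' where eq: "p = (i, r)" "q = (i', r')"
        by (cases p, cases q) auto
      obtain B where B: "B \<in> L" "B \<subseteq> cell v i \<union> cell v (i + r)" "B \<subseteq> cell v i' \<union> cell v (i' + r')"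
        using pq(4) eq by auto
      have "m dvd i - i'" "r = r'"
        using cross_pair_unique[OF B(2,3) cross[OF B(1)]] pq(1,2) eq by auto
      moreover have "\<bar>i - i'\<bar> < m"
        using pq(1,2) eq by auto
      ultimately show False
        using dvd_small_eq_0[of "i - i'"] pq(3) eq by simp
    qed
  qed (use fin in auto)
  also have "\<dots> = (\<Sum>i\<in>{1..m}. \<Sum>r\<in>{1..h}. sum F {B \<in> L. B \<subseteq> cell v i \<union> cell v (i + r)})"
    by (subst sum.cartesian_product) (simp add: case_prod_unfold)
  finally show ?thesis .
qed

section \<open>Sums and differences on the cells\<close>

definition cell_sum :: "('a \<Rightarrow> complex) \<Rightarrow> int \<Rightarrow> complex" where
  "cell_sum x i = x (v (2 * i - 1)) + x (v (2 * i))"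

definition cell_diff :: "('a \<Rightarrow> complex) \<Rightarrow> int \<Rightarrow> complex" where
  "cell_diff x i = x (v (2 * i - 1)) - x (v (2 * i))"

lemma cell_sum_periodic: "cell_sum x (i + m) = cell_sum x i"
  using periodic[of "2 * i"] periodic[of "2 * i - 1"] by (simp add: cell_sum_def algebra_simps)

lemma cell_diff_periodic: "cell_diff x (i + m) = cell_diff x i"
  using periodic[of "2 * i"] periodic[of "2 * i - 1"] by (simp add: cell_diff_def algebra_simps)

lemma sum_over_cell: "sum x (cell v i) = cell_sum x i"
  by (simp add: sum_cell cell_sum_def)

text \<open>
  The matrix \<open>Q\<close> above is \<open>rotate_diffs 1\<close>, its inverse \<open>rotate_diffs (- 1)\<close>. The value at a
  vertex outside \<open>C \<union> D\<close> is irrelevant.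
\<close>

definition rotate_diffs :: "int \<Rightarrow> ('a \<Rightarrow> complex) \<Rightarrow> 'a \<Rightarrow> complex" where
  "rotate_diffs c x w = (if w \<in> D then x w else
     let j = inv_into {1..2 * m} v w; i = (j + 1) div 2
     in (cell_sum x i + (if odd j then 1 else - 1) * cell_diff x (i - c)) / 2)"

lemma rotate_diffs_D: "w \<in> D \<Longrightarrow> rotate_diffs c x w = x w"
  by (simp add: rotate_diffs_def)

text \<open>The definition of \<open>rotate_diffs\<close> looks up an index in one period only;
  periodicity of \<open>v\<close>, \<open>cell_sum\<close> and \<open>cell_diff\<close> extends the
  formulas to all integers \<open>i\<close>.\<close>

lemma rotate_diffs_cell:
  "rotate_diffs c x (v (2 * i - 1)) = (cell_sum x i + cell_diff x (i - c)) / 2"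
  "rotate_diffs c x (v (2 * i)) = (cell_sum x i - cell_diff x (i - c)) / 2"
proof -
  obtain i0 q where i: "i0 \<in> {1..m}" "i = i0 + q * m"
    by (rule period_representative)
  have v: "v (2 * i - 1) = v (2 * i0 - 1)" "v (2 * i) = v (2 * i0)"
    using periodic_mult[of v "2 * m", OF periodic, of "2 * i0 - 1" q]
      periodic_mult[of v "2 * m", OF periodic, of "2 * i0" q] i by (simp_all add: algebra_simps)
  have s: "cell_sum x i = cell_sum x i0" and d: "cell_diff x (i - c) = cell_diff x (i0 - c)"
    using periodic_mult[of "cell_sum x" m, OF cell_sum_periodic, of i0 q]
      periodic_mult[of "cell_diff x" m, OF cell_diff_periodic, of "i0 - c" q] i
    by (simp_all add: algebra_simps)
  have "inv_into {1..2 * m} v (v (2 * i0 - 1)) = 2 * i0 - 1" "inv_into {1..2 * m} v (v (2 * i0)) = 2 * i0"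
    using i inj by (auto intro!: inv_into_f_f)
  moreover have "v (2 * i0 - 1) \<notin> D" "v (2 * i0) \<notin> D"
    using v_in_C C_disjoint_D by blast+
  ultimately show "rotate_diffs c x (v (2 * i - 1)) = (cell_sum x i + cell_diff x (i - c)) / 2"
    "rotate_diffs c x (v (2 * i)) = (cell_sum x i - cell_diff x (i - c)) / 2"
    unfolding v s d by (simp_all add: rotate_diffs_def Let_def)
qed

lemma cell_sum_rotate_diffs: "cell_sum (rotate_diffs c x) i = cell_sum x i"
  unfolding cell_sum_def[of "rotate_diffs c x"] rotate_diffs_cell by (simp add: field_simps)

lemma cell_diff_rotate_diffs: "cell_diff (rotate_diffs c x) i = cell_diff x (i - c)"
  unfolding cell_diff_def[of "rotate_diffs c x"] rotate_diffs_cell by (simp add: field_simps)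

text \<open>On the cell \<open>i\<close>, the rotated vector and the translate of \<open>x\<close>
  by two indices have the same difference \<open>cell_diff x (i - 1)\<close>; only their sums
  differ, so they differ by a constant on the cell. These corrections cancel in the cyclic sums
  below.\<close>

lemma rotate_diffs_shift:
  assumes "j \<in> {2 * i - 1, 2 * i}"
  shows "rotate_diffs 1 x (v j) = x (v (j - 2)) + (cell_sum x i - cell_sum x (i - 1)) / 2"
proof -
  consider "j = 2 * i - 1" | "j = 2 * i"
    using assms by auto
  then show ?thesis
    by cases (simp_all add: rotate_diffs_cell, simp_all add: cell_sum_def cell_diff_def field_simps)
qed

lemma rotate_diffs_linear:
  "rotate_diffs c (\<lambda>u. x u + t * y u) w = rotate_diffs c x w + t * rotate_diffs c y w"
  by (simp add: rotate_diffs_def cell_sum_def cell_diff_def Let_def field_simps)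

lemma rotate_diffs_inverse:
  assumes "w \<in> C \<union> D"
  shows "rotate_diffs c (rotate_diffs (- c) x) w = x w"
proof (cases "w \<in> D")
  case False
  then obtain i j where "j \<in> {2 * i - 1, 2 * i}" "w = v j"
    using assms C_cases by blast
  then show ?thesis
    by (auto simp: rotate_diffs_cell(1,2)[where x = "rotate_diffs (- c) x"]
        cell_sum_rotate_diffs cell_diff_rotate_diffs) (auto simp: cell_sum_def cell_diff_def)
qed (simp add: rotate_diffs_D)

text \<open>On each cell the pairing is half the product of the sums plus half the product of the
  differences. The sums are fixed and the differences only permuted cyclically.\<close>

lemma rotate_diffs_isometry:
  "(\<Sum>w\<in>C \<union> D. rotate_diffs c x w * rotate_diffs c y w) = (\<Sum>w\<in>C \<union> D. x w * y w)"
proof -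
  have C: "(\<Sum>w\<in>C. x w * y w) = (\<Sum>i\<in>{1..m}. cell_sum x i * cell_sum y i / 2) +
      (\<Sum>i\<in>{1..m}. cell_diff x i * cell_diff y i / 2)" for x y
    unfolding sum_C sum_cell sum.distrib[symmetric]
    by (intro sum.cong refl) (simp add: cell_sum_def cell_diff_def field_simps)
  have "(\<Sum>w\<in>C. rotate_diffs c x w * rotate_diffs c y w) = (\<Sum>w\<in>C. x w * y w)"
    using sum_shift[of "\<lambda>i. cell_diff x i * cell_diff y i / 2" "- c"]
    unfolding C by (simp add: cell_sum_rotate_diffs cell_diff_rotate_diffs cell_diff_periodic)
  then show ?thesis
    by (simp add: sum.union_disjoint finite_C finite_D C_disjoint_D rotate_diffs_D)
qed

section \<open>Sorting edges by their trace on \<open>D\<close>\<close>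

definition outer_parts :: "'a set set \<Rightarrow> 'a set \<Rightarrow> 'a set set" where
  "outer_parts E A = {B. B \<subseteq> C \<and> A \<union> B \<in> E}"

lemma union_eq_iff:
  assumes "A \<subseteq> D" "A' \<subseteq> D" "B \<subseteq> C" "B' \<subseteq> C"
  shows "A \<union> B = A' \<union> B' \<longleftrightarrow> A = A' \<and> B = B'"
  using assms C_disjoint_D by blast

lemma finite_outer_parts: "finite (outer_parts E A)"
  by (rule finite_subset[of _ "Pow C"]) (auto simp: outer_parts_def finite_C)

text \<open>Since \<open>C\<close> and \<open>D\<close> are disjoint, an edge \<open>e\<close>
  amounts to the pair of \<open>e \<inter> D\<close> and \<open>e \<inter> C\<close>. As the
  substitution fixes the entries on \<open>D\<close>, the inner sums can be compared separately for
  each \<open>A\<close>.\<close>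

lemma edge_form_decompose:
  assumes "\<Union>E \<subseteq> C \<union> D"
  shows "edge_form E x =
    (\<Sum>A\<in>Pow D. (\<Prod>w\<in>A. x w) * (\<Sum>B\<in>outer_parts E A. \<Prod>w\<in>B. x w))"
proof -
  have "(\<Sum>A\<in>Pow D. (\<Prod>w\<in>A. x w) * (\<Sum>B\<in>outer_parts E A. \<Prod>w\<in>B. x w)) =
      (\<Sum>(A, B)\<in>Sigma (Pow D) (outer_parts E). (\<Prod>w\<in>A. x w) * (\<Prod>w\<in>B. x w))"
    unfolding sum_distrib_left
    by (rule sum.Sigma) (auto simp: finite_D finite_outer_parts)
  also have "\<dots> = edge_form E x"
    unfolding edge_form_def
  proof (rule sum.reindex_bij_witness[of _ "\<lambda>e. (e \<inter> D, e \<inter> C)" "\<lambda>(A, B). A \<union> B"])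
    fix p assume "p \<in> Sigma (Pow D) (outer_parts E)"
    then obtain A B where p: "p = (A, B)" and AB: "A \<subseteq> D" "B \<subseteq> C" "A \<union> B \<in> E"
      by (auto simp: outer_parts_def)
    have "A \<inter> B = {}" "finite A" "finite B"
      using AB C_disjoint_D finite_subset[OF _ finite_C] finite_subset[OF _ finite_D] by auto
    then show "(case p of (A, B) \<Rightarrow> A \<union> B) \<in> E"
      "((case p of (A, B) \<Rightarrow> A \<union> B) \<inter> D, (case p of (A, B) \<Rightarrow> A \<union> B) \<inter> C) = p"
      "(\<Prod>w\<in>(case p of (A, B) \<Rightarrow> A \<union> B). x w) =
        (case p of (A, B) \<Rightarrow> (\<Prod>w\<in>A. x w) * (\<Prod>w\<in>B. x w))"
      using p AB C_disjoint_D by (auto simp: prod.union_disjoint)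
  next
    fix e assume e: "e \<in> E"
    then have "e \<inter> D \<union> e \<inter> C = e"
      using assms by blast
    then show "(case (e \<inter> D, e \<inter> C) of (A, B) \<Rightarrow> A \<union> B) = e"
      "(e \<inter> D, e \<inter> C) \<in> Sigma (Pow D) (outer_parts E)"
      using e by (auto simp: outer_parts_def)
  qed
  finally show ?thesis ..
qed

end

section \<open>The switched hypergraph\<close>

locale cell_switching = cyclic_cells m h v D
  for m h :: int and v :: "int \<Rightarrow> 'a" and D :: "'a set" +
  fixes k :: nat and G :: "'a hypergraph" and \<pi> :: "'a \<Rightarrow> 'a"
  assumes k: "k \<ge> 2"
    and G: "uniform_hypergraph k G"
    and verts: "verts G = C \<union> D"
    and \<pi>: "\<pi> (v j) = v (j - 2)"
    and at_most_two: "e \<in> edges G \<Longrightarrow> card (e - D) \<le> 2"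
    and cond1: "A \<in> nsets D (k - 1) \<Longrightarrow> i \<in> {1..m} \<Longrightarrow> j \<in> {1..m} \<Longrightarrow>
      card (neighbours G A \<inter> cell v i) mod 2 = card (neighbours G A \<inter> cell v j) mod 2"
    and near: "A \<in> nsets D (k - 2) \<Longrightarrow> i \<in> {1..m} \<Longrightarrow> i < j \<Longrightarrow> j < i + h \<Longrightarrow>
      edges (link k G (cell v i \<union> cell v j) A) = {} \<or>
      edges (link k G (cell v i \<union> cell v j) A) = {{y, x} | y x. y \<in> cell v i \<and> x \<in> cell v j}"
    and far: "A \<in> nsets D (k - 2) \<Longrightarrow> i \<in> {1..m} \<Longrightarrow> j = i + h \<Longrightarrow>
      edges (link k G (cell v i \<union> cell v j) A) = {{v (2 * i - 1), x} | x. x \<in> cell v j} \<or>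
      edges (link k G (cell v i \<union> cell v j) A) = {{v (2 * i), x} | x. x \<in> cell v j}"
begin

abbreviation H :: "'a hypergraph" where "H \<equiv> switched k m v D \<pi> G"

section \<open>Links and centres of stars\<close>

lemma mem_link_iff:
  assumes "A \<in> nsets D (k - 2)"
  shows "f \<in> edges (link k E S A) \<longleftrightarrow> f \<in> nsets S 2 \<and> f \<union> A \<in> edges E"
  using assms k by (auto simp: link_def nsets_def)

text \<open>An index rather than a vertex is recorded, so that applying \<pi> becomes subtracting
  \<open>2\<close>. For a \<open>(k - 2)\<close>-subset \<open>A\<close> of \<open>D\<close> the
  default \<open>2 * i\<close> is correct, because \<open>far\<close>, extended by periodicity,
  leaves only the other star.\<close>

definition centre :: "'a set \<Rightarrow> int \<Rightarrow> int" where
  "centre A i =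
    (if edges (link k G (cell v i \<union> cell v (i + h)) A) = {{v (2 * i - 1), x} | x. x \<in> cell v (i + h)}
     then 2 * i - 1 else 2 * i)"

lemma centre_cases: "centre A i \<in> {2 * i - 1, 2 * i}"
  by (simp add: centre_def)

lemma v_centre_in_cell: "v (centre A i) \<in> cell v i"
  using centre_cases[of A i] by (auto simp: cell_def)

lemma v_centre_shift_in_cell: "v (centre A i - 2) \<in> cell v (i - 1)"
  using centre_cases[of A i] by (auto simp: cell_def right_diff_distrib)

lemma centre_periodic: "centre A (i + m) = centre A i + 2 * m"
proof -
  have "cell v (i + m + h) = cell v (i + h)"
    using cell_periodic[of "i + h"] by (simp add: algebra_simps)
  moreover have "v (2 * (i + m) - 1) = v (2 * i - 1)"
    using periodic[of "2 * i - 1"] by (simp add: algebra_simps)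
  ultimately show ?thesis
    by (simp add: centre_def cell_periodic)
qed

lemma link_far:
  assumes A: "A \<in> nsets D (k - 2)"
  shows "edges (link k G (cell v i \<union> cell v (i + h)) A) = {{v (centre A i), x} | x. x \<in> cell v (i + h)}"
proof -
  obtain i0 q where i: "i0 \<in> {1..m}" "i = i0 + q * m"
    by (rule period_representative)
  have cells: "cell v i = cell v i0" "cell v (i + h) = cell v (i0 + h)"
    using cell_periodic_mult[of i0 q] cell_periodic_mult[of "i0 + h" q] i by (simp_all add: algebra_simps)
  have vs: "v (2 * i - 1) = v (2 * i0 - 1)" "v (2 * i) = v (2 * i0)"
    using periodic_mult[of v "2 * m", OF periodic, of "2 * i0 - 1" q]
      periodic_mult[of v "2 * m", OF periodic, of "2 * i0" q] i by (simp_all add: algebra_simps)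
  show ?thesis
    using far[OF A i(1) refl] by (auto simp only: centre_def cells vs split: if_splits)
qed

lemma link_near:
  assumes A: "A \<in> nsets D (k - 2)" and r: "0 < r" "r < h"
  shows "edges (link k G (cell v i \<union> cell v (i + r)) A) = {} \<or>
    edges (link k G (cell v i \<union> cell v (i + r)) A) = {{y, x} | y x. y \<in> cell v i \<and> x \<in> cell v (i + r)}"
proof -
  obtain i0 q where i: "i0 \<in> {1..m}" "i = i0 + q * m"
    by (rule period_representative)
  have cells: "cell v i = cell v i0" "cell v (i + r) = cell v (i0 + r)"
    using cell_periodic_mult[of i0 q] cell_periodic_mult[of "i0 + r" q] i by (simp_all add: algebra_simps)
  show ?thesis
    using near[OF A i(1), of "i0 + r"] r by (simp only: cells)
qed

text \<open>The two possible stars share no edge, so a single edge between the cells already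
  identifies the centre.\<close>

lemma far_edge_iff:
  assumes A: "A \<in> nsets D (k - 2)" and a: "a \<in> {2 * i - 1, 2 * i}" and x: "x \<in> cell v (i + h)"
  shows "A \<union> {v a, x} \<in> edges G \<longleftrightarrow> a = centre A i"
proof -
  have disj: "cell v i \<inter> cell v (i + h) = {}"
    using cells_disjoint_offset[of h] h_pos by simp
  have va: "v a \<in> cell v i"
    using a by (auto simp: cell_def)
  then have "v a \<noteq> x"
    using x disj by blast
  then have "{v a, x} \<in> nsets (cell v i \<union> cell v (i + h)) 2"
    using x va by (simp add: nsets_def)
  then have "A \<union> {v a, x} \<in> edges G \<longleftrightarrow> {v a, x} \<in> edges (link k G (cell v i \<union> cell v (i + h)) A)"
    using A by (simp add: mem_link_iff Un_commute)
  also have "\<dots> \<longleftrightarrow> v a = v (centre A i)"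
    unfolding link_far[OF A] using disj va x v_centre_in_cell[of A i]
    by (auto simp: doubleton_eq_iff)
  also have "\<dots> \<longleftrightarrow> a = centre A i"
    using a centre_cases[of A i] v_Suc_neq[of i] by (metis insert_iff singletonD)
  finally show ?thesis .
qed

section \<open>Membership in the switched edge set by trace and outer part\<close>

lemma removed1_iff:
  assumes "A \<subseteq> D" "B \<subseteq> C"
  shows "A \<union> B \<in> removed1 k m v D G \<longleftrightarrow>
    A \<in> one_per_cell k m v D G \<and> (\<exists>x\<in>C \<inter> neighbours G A. B = {x})"
proof
  assume "A \<union> B \<in> removed1 k m v D G"
  then obtain x A' i where A': "A' \<in> one_per_cell k m v D G"
    and x: "x \<in> neighbours G A'" "x \<in> cell v i" and eq: "A \<union> B = A' \<union> {x}"
    by (auto simp: removed1_def)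
  have "A = A' \<and> B = {x}"
    using union_eq_iff[of A A' B "{x}"] assms A' x cell_subset_C[of i] eq
    by (auto simp: one_per_cell_def nsets_def)
  then show "A \<in> one_per_cell k m v D G \<and> (\<exists>x\<in>C \<inter> neighbours G A. B = {x})"
    using A' x cell_subset_C by blast
next
  assume "A \<in> one_per_cell k m v D G \<and> (\<exists>x\<in>C \<inter> neighbours G A. B = {x})"
  then show "A \<union> B \<in> removed1 k m v D G"
    unfolding removed1_def C_def by blast
qed

lemma \<pi>_in_C: "x \<in> C \<Longrightarrow> \<pi> x \<in> C"
  by (metis C_cases \<pi> v_in_C)

lemma added1_iff:
  assumes "A \<subseteq> D" "B \<subseteq> C"
  shows "A \<union> B \<in> added1 k m v D \<pi> G \<longleftrightarrow>
    A \<in> one_per_cell k m v D G \<and> (\<exists>x\<in>C \<inter> neighbours G A. B = {\<pi> x})"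
proof
  assume "A \<union> B \<in> added1 k m v D \<pi> G"
  then obtain x A' i where A': "A' \<in> one_per_cell k m v D G"
    and x: "x \<in> neighbours G A'" "x \<in> cell v i" and eq: "A \<union> B = A' \<union> {\<pi> x}"
    by (auto simp: added1_def)
  have "A = A' \<and> B = {\<pi> x}"
    using union_eq_iff[of A A' B "{\<pi> x}"] assms A' x cell_subset_C[of i] eq \<pi>_in_C[of x]
    by (auto simp: one_per_cell_def nsets_def)
  then show "A \<in> one_per_cell k m v D G \<and> (\<exists>x\<in>C \<inter> neighbours G A. B = {\<pi> x})"
    using A' x cell_subset_C by blast
next
  assume "A \<in> one_per_cell k m v D G \<and> (\<exists>x\<in>C \<inter> neighbours G A. B = {\<pi> x})"
  then show "A \<union> B \<in> added1 k m v D \<pi> G"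
    unfolding added1_def C_def by blast
qed

lemma edge_cardD:
  assumes "A \<subseteq> D" "B \<subseteq> C" "A \<union> B \<in> edges G"
  shows "finite A" "finite B" "card A + card B = k" "card B \<le> 2"
proof -
  note e = uniform_hypergraph_edgeD[OF G assms(3)]
  show fin: "finite A" "finite B"
    using e(2) by auto
  have "A \<inter> B = {}" "(A \<union> B) - D = B"
    using assms C_disjoint_D by auto
  then show "card A + card B = k" "card B \<le> 2"
    using e(3) at_most_two[OF assms(3)] fin by (auto simp: card_Un_disjoint)
qed

lemma half_eq: "(m - 1) div 2 = h"
  using m_eq by simp

lemma removed2_iff:
  assumes AB: "A \<subseteq> D" "B \<subseteq> C"
  shows "A \<union> B \<in> removed2 k m v D G \<longleftrightarrow>
    A \<in> nsets D (k - 2) \<and> A \<union> B \<in> edges G \<and> (\<exists>i\<in>{1..m}. B \<subseteq> cell v i \<union> cell v (i + h))"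
proof
  assume "A \<union> B \<in> removed2 k m v D G"
  then obtain A' i where A': "A' \<in> nsets D (k - 2)" and i: "i \<in> {1..m}" and e: "A \<union> B \<in> edges G"
    and sub: "A \<union> B \<subseteq> A' \<union> cell v i \<union> cell v (i + h)"
    by (auto simp: removed2_def induced_def half_eq)
  note card = edge_cardD[OF AB e]
  have A'D: "A' \<subseteq> D" "finite A'" "card A' = k - 2"
    using A' by (auto simp: nsets_def)
  have "A \<subseteq> A'"
    using sub AB C_disjoint_D cell_subset_C by blast
  \<comment> \<open>An edge has at most two vertices outside \<open>D\<close>, so \<open>A\<close>
    has at least \<open>k - 2\<close> elements and must fill up \<open>A'\<close>.\<close>
  then have "A = A'"
    using A'D card by (intro card_seteq) auto
  moreover have "B \<subseteq> cell v i \<union> cell v (i + h)"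
    using sub AB A'D C_disjoint_D by blast
  ultimately show "A \<in> nsets D (k - 2) \<and> A \<union> B \<in> edges G \<and>
      (\<exists>i\<in>{1..m}. B \<subseteq> cell v i \<union> cell v (i + h))"
    using A' i e by blast
next
  assume "A \<in> nsets D (k - 2) \<and> A \<union> B \<in> edges G \<and>
    (\<exists>i\<in>{1..m}. B \<subseteq> cell v i \<union> cell v (i + h))"
  then obtain i where "A \<in> nsets D (k - 2)" "A \<union> B \<in> edges G" "i \<in> {1..m}"
    "A \<union> B \<subseteq> A \<union> cell v i \<union> cell v (i + h)"
    by blast
  then show "A \<union> B \<in> removed2 k m v D G"
    unfolding removed2_def induced_def half_eq hypergraph.sel by blast
qed

text \<open>Because \<open>(i + h + 1) + h = i + m\<close>, the cell \<open>i\<close> is the leaf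
  side of the star of \<open>G\<close> centred in the cell \<open>i + h + 1\<close>. Exactly one of
  the two tests in \<open>added2\<close> succeeds, and either outcome lowers the index of the centre
  by \<open>2\<close>.\<close>

lemma added2_eq:
  "added2 k m v D G =
    (\<Union>A\<in>nsets D (k - 2). \<Union>i\<in>{1..m}. {A \<union> {v (centre A (i + h + 1) - 2), x} | x. x \<in> cell v i})"
  unfolding added2_def
proof (intro SUP_cong refl)
  fix A i assume A: "A \<in> nsets D (k - 2)"
  let ?j = "i + h + 1"
  have j: "2 * i + m = 2 * ?j - 1" "2 * ?j - 1 + 1 = 2 * ?j"
    "2 * i - 2 + m = 2 * ?j - 1 - 2" "2 * i - 1 + m = 2 * ?j - 2"
    using m_eq by simp_all
  have cell: "cell v i = cell v (?j + h)"
    using cell_periodic[of i] m_eq by (simp add: algebra_simps)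
  have iff: "{A \<union> {v a, x} | x. x \<in> cell v i} \<subseteq> edges G \<longleftrightarrow> a = centre A ?j"
    if "a = 2 * ?j - 1 \<or> a = 2 * ?j" for a
  proof -
    have "{A \<union> {v a, x} | x. x \<in> cell v i} \<subseteq> edges G \<longleftrightarrow> (\<forall>x\<in>cell v i. A \<union> {v a, x} \<in> edges G)"
      by blast
    also have "\<dots> \<longleftrightarrow> (\<forall>x\<in>cell v i. a = centre A ?j)"
      using far_edge_iff[OF A, of a ?j] that unfolding cell by blast
    also have "\<dots> \<longleftrightarrow> a = centre A ?j"
      by (auto simp: cell_def)
    finally show ?thesis .
  qed
  show "(if {A \<union> {v (2 * i + m), x} | x. x \<in> cell v i} \<subseteq> edges G
         then {A \<union> {v (2 * i - 2 + m), x} | x. x \<in> cell v i} else {}) \<union>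
        (if {A \<union> {v (2 * i + m + 1), x} | x. x \<in> cell v i} \<subseteq> edges G
         then {A \<union> {v (2 * i - 1 + m), x} | x. x \<in> cell v i} else {}) =
        {A \<union> {v (centre A ?j - 2), x} | x. x \<in> cell v i}"
    unfolding j iff[OF disjI1[OF refl]] iff[OF disjI2[OF refl]]
    using centre_cases[of A ?j] by auto
qed

lemma added2_iff:
  assumes "A \<subseteq> D" "B \<subseteq> C"
  shows "A \<union> B \<in> added2 k m v D G \<longleftrightarrow>
    A \<in> nsets D (k - 2) \<and> (\<exists>i\<in>{1..m}. \<exists>x\<in>cell v i. B = {v (centre A (i + h + 1) - 2), x})"
proof
  assume "A \<union> B \<in> added2 k m v D G"
  then obtain A' i x where A': "A' \<in> nsets D (k - 2)" and i: "i \<in> {1..m}" and x: "x \<in> cell v i"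
    and eq: "A \<union> B = A' \<union> {v (centre A' (i + h + 1) - 2), x}"
    unfolding added2_eq by blast
  have "{v (centre A' (i + h + 1) - 2), x} \<subseteq> C"
    using v_in_C x cell_subset_C by blast
  moreover have "A' \<subseteq> D"
    using A' by (simp add: nsets_def)
  ultimately have "A = A'" "B = {v (centre A' (i + h + 1) - 2), x}"
    using union_eq_iff assms eq by blast+
  then show "A \<in> nsets D (k - 2) \<and> (\<exists>i\<in>{1..m}. \<exists>x\<in>cell v i. B = {v (centre A (i + h + 1) - 2), x})"
    using A' i x by blast
next
  assume "A \<in> nsets D (k - 2) \<and> (\<exists>i\<in>{1..m}. \<exists>x\<in>cell v i. B = {v (centre A (i + h + 1) - 2), x})"
  then show "A \<union> B \<in> added2 k m v D G"
    unfolding added2_eq by blast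
qed

lemma v_new_centre_in_cell: "v (centre A (i + h + 1) - 2) \<in> cell v (i + h)"
  using v_centre_shift_in_cell[of A "i + h + 1"] by (simp add: algebra_simps)

lemma edges_switched_iff:
  "e \<in> edges H \<longleftrightarrow> (e \<in> edges G \<and> e \<notin> removed1 k m v D G \<and> e \<notin> removed2 k m v D G) \<or>
    e \<in> added1 k m v D \<pi> G \<or> e \<in> added2 k m v D G"
  by (auto simp: switched_def)

lemma verts_switched: "verts H = C \<union> D"
  by (simp add: switched_def verts)

text \<open>The point is that added sets have full size: a new centre lies in the cell
  \<open>i + h\<close>, disjoint from the cell \<open>i\<close> of its leaf, and vertices of
  \<open>C\<close> avoid \<open>A\<close>.\<close>

lemma uniform_switched: "uniform_hypergraph k H"
proof -
  have "e \<in> nsets (C \<union> D) k" if e: "e \<in> edges H" for e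
  proof -
    consider "e \<in> edges G" | "e \<in> added1 k m v D \<pi> G" | "e \<in> added2 k m v D G"
      using e edges_switched_iff by blast
    then show ?thesis
    proof cases
      case 1
      then show ?thesis
        using uniform_hypergraph_edgeD[OF G] verts by (auto simp: nsets_def)
    next
      case 2
      then obtain A i x where A: "A \<in> nsets D (k - 1)" and x: "x \<in> cell v i" and e: "e = insert (\<pi> x) A"
        by (auto simp: added1_def one_per_cell_def)
      have \<pi>x: "\<pi> x \<in> C"
        using \<pi>_in_C x cell_subset_C by blast
      then have "\<pi> x \<notin> A"
        using A C_disjoint_D by (auto simp: nsets_def)
      then show ?thesis
        using A \<pi>x k e by (auto simp: nsets_def)
    next
      case 3
      then obtain A i x where A: "A \<in> nsets D (k - 2)" and x: "x \<in> cell v i"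
        and e: "e = A \<union> {v (centre A (i + h + 1) - 2), x}"
        unfolding added2_eq by blast
      let ?c = "v (centre A (i + h + 1) - 2)"
      have c: "?c \<noteq> x"
        using v_new_centre_in_cell[of A i] x cells_disjoint_offset[of h i] h_pos by auto
      have C: "?c \<in> C" "x \<in> C"
        using v_in_C x cell_subset_C by blast+
      then have "?c \<notin> A" "x \<notin> A"
        using A C_disjoint_D by (auto simp: nsets_def)
      then show ?thesis
        using A C c k e by (auto simp: nsets_def)
    qed
  qed
  then show ?thesis
    by (auto simp: uniform_hypergraph_def verts_switched finite_C finite_D)
qed

section \<open>Traces with \<open>k - 2\<close> vertices: the quadratic forms\<close>

lemma outer_parts_2:
  assumes A: "A \<in> nsets D (k - 2)" and E: "uniform_hypergraph k E"
    and B: "B \<subseteq> C" "A \<union> B \<in> edges E"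
  shows "B \<in> nsets C 2"
proof -
  note e = uniform_hypergraph_edgeD[OF E B(2)]
  have "finite B" "A \<inter> B = {}" "finite A" "card A = k - 2"
    using e(2) A B(1) C_disjoint_D by (auto simp: nsets_def)
  then show ?thesis
    using e(3) k B(1) by (simp add: nsets_def card_Un_disjoint)
qed

text \<open>The link of \<open>A\<close> on the cells \<open>j\<close> and \<open>j + h\<close> is a
  star whose edges all reach the cell \<open>j + h\<close>, so none lies inside the cell
  \<open>j\<close>.\<close>

lemma edge_crosses_cells:
  assumes A: "A \<in> nsets D (k - 2)" and B: "B \<subseteq> C" "A \<union> B \<in> edges G"
  shows "\<not> B \<subseteq> cell v j"
proof
  assume sub: "B \<subseteq> cell v j"
  then have "B \<in> nsets (cell v j \<union> cell v (j + h)) 2"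
    using outer_parts_2[OF A G B] by (auto simp: nsets_def)
  then have "B \<in> edges (link k G (cell v j \<union> cell v (j + h)) A)"
    using A B by (simp add: mem_link_iff Un_commute)
  then obtain x where "x \<in> B" "x \<in> cell v (j + h)"
    unfolding link_far[OF A] by blast
  then show False
    using sub cells_disjoint_offset[of h j] h_pos by auto
qed

lemma edges_switched_2_iff:
  assumes A: "A \<in> nsets D (k - 2)" and B: "B \<subseteq> C"
  shows "A \<union> B \<in> edges H \<longleftrightarrow>
    (A \<union> B \<in> edges G \<and> \<not> (\<exists>i\<in>{1..m}. B \<subseteq> cell v i \<union> cell v (i + h))) \<or>
    (\<exists>i\<in>{1..m}. \<exists>x\<in>cell v i. B = {v (centre A (i + h + 1) - 2), x})"
proof -
  have "A \<notin> one_per_cell k m v D G" "A \<subseteq> D"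
    using A k by (auto simp: one_per_cell_def nsets_def)
  then show ?thesis
    using A B by (auto simp: edges_switched_iff removed1_iff added1_iff removed2_iff added2_iff)
qed

lemma new_edge:
  fixes A :: "'a set"
  assumes "x \<in> cell v i"
  defines "B \<equiv> {v (centre A (i + h + 1) - 2), x}"
  shows "B \<in> nsets (cell v i \<union> cell v (i + h)) 2" "\<not> B \<subseteq> cell v j"
proof -
  let ?c = "v (centre A (i + h + 1) - 2)"
  have c: "?c \<in> cell v (i + h)" "?c \<noteq> x"
    using v_new_centre_in_cell[of A i] assms(1) cells_disjoint_offset[of h i] h_pos by auto
  then show "B \<in> nsets (cell v i \<union> cell v (i + h)) 2"
    using assms(1) by (simp add: B_def nsets_def)
  show "\<not> B \<subseteq> cell v j"
  proof
    assume "B \<subseteq> cell v j"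
    then have "m dvd i - j" "m dvd i + h - j"
      using c(1) assms cells_meetD by (auto simp: B_def)
    then have "m dvd h"
      using dvd_diff[of m "i + h - j" "i - j"] by simp
    then show False
      using dvd_small_eq_0[of h] h_pos m_eq by simp
  qed
qed

lemma switched_edge_crosses_cells:
  assumes "A \<in> nsets D (k - 2)" "B \<subseteq> C" "A \<union> B \<in> edges H"
  shows "\<not> B \<subseteq> cell v j"
  using assms edge_crosses_cells new_edge(2) by (auto simp: edges_switched_2_iff)

text \<open>By uniqueness of the step, a pair at cyclic distance \<open>r < h\<close> is never one
  at distance \<open>h\<close>, and with trace \<open>A\<close> only pairs of the latter kind are
  removed or added.\<close>

lemma link_switched_near:
  assumes A: "A \<in> nsets D (k - 2)" and r: "0 < r" "r < h"
  shows "edges (link k H (cell v i \<union> cell v (i + r)) A) = edges (link k G (cell v i \<union> cell v (i + r)) A)"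
proof -
  have "A \<union> f \<in> edges H \<longleftrightarrow> A \<union> f \<in> edges G" if f: "f \<in> nsets (cell v i \<union> cell v (i + r)) 2" for f
  proof -
    have sub: "f \<subseteq> cell v i \<union> cell v (i + r)"
      using f by (auto simp: nsets_def)
    then have C: "f \<subseteq> C"
      using cell_subset_C by blast
    have not_far: False
      if "f \<subseteq> cell v i' \<union> cell v (i' + h)" "\<And>j. \<not> f \<subseteq> cell v j" for i'
      using cross_pair_unique(2)[OF sub that] r by auto
    show ?thesis
      unfolding edges_switched_2_iff[OF A C]
    proof (intro iffI; (elim disjE bexE conjE)?)
      fix i' x assume x: "x \<in> cell v i'" and eq: "f = {v (centre A (i' + h + 1) - 2), x}"
      have "f \<subseteq> cell v i' \<union> cell v (i' + h)" "\<And>j. \<not> f \<subseteq> cell v j"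
        using new_edge[OF x, of A] unfolding eq by (simp_all add: nsets_def)
      then show "A \<union> f \<in> edges G"
        using not_far by blast
    next
      assume "A \<union> f \<in> edges G"
      then show "A \<union> f \<in> edges G \<and> \<not> (\<exists>i\<in>{1..m}. f \<subseteq> cell v i \<union> cell v (i + h)) \<or>
          (\<exists>i\<in>{1..m}. \<exists>x\<in>cell v i. f = {v (centre A (i + h + 1) - 2), x})"
        using not_far edge_crosses_cells[OF A C] by blast
    qed
  qed
  then show ?thesis
    using A by (auto simp: mem_link_iff Un_commute)
qed

text \<open>All old edges between these cells are removed, which leaves the new star. Its
  orientation is opposite to that in \<open>G\<close>: the centre lies in the cell
  \<open>i + h\<close>, the leaves in the cell \<open>i\<close>.\<close>

lemma link_switched_far:
  assumes A: "A \<in> nsets D (k - 2)" and i: "i \<in> {1..m}"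
  shows "edges (link k H (cell v i \<union> cell v (i + h)) A) =
    {{v (centre A (i + h + 1) - 2), x} | x. x \<in> cell v i}"
proof (intro equalityI subsetI)
  fix f assume "f \<in> edges (link k H (cell v i \<union> cell v (i + h)) A)"
  then have f: "f \<in> nsets (cell v i \<union> cell v (i + h)) 2" "A \<union> f \<in> edges H"
    using A by (simp_all add: mem_link_iff Un_commute)
  have sub: "f \<subseteq> cell v i \<union> cell v (i + h)"
    using f(1) by (auto simp: nsets_def)
  then have C: "f \<subseteq> C"
    using cell_subset_C by blast
  obtain i' x where i': "i' \<in> {1..m}" and x: "x \<in> cell v i'"
    and eq: "f = {v (centre A (i' + h + 1) - 2), x}"
    using f(2) i sub edges_switched_2_iff[OF A C] by blast
  have "f \<subseteq> cell v i' \<union> cell v (i' + h)" "\<And>j. \<not> f \<subseteq> cell v j"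
    using new_edge[OF x, of A] unfolding eq by (simp_all add: nsets_def)
  then have "m dvd i - i'"
    using cross_pair_unique(1)[OF sub] h_pos by auto
  moreover have "\<bar>i - i'\<bar> < m"
    using i i' by auto
  ultimately have "i = i'"
    using dvd_small_eq_0[of "i - i'"] by simp
  then show "f \<in> {{v (centre A (i + h + 1) - 2), x} | x. x \<in> cell v i}"
    using eq x by blast
next
  fix f assume "f \<in> {{v (centre A (i + h + 1) - 2), x} | x. x \<in> cell v i}"
  then obtain x where x: "x \<in> cell v i" and eq: "f = {v (centre A (i + h + 1) - 2), x}"
    by blast
  have f: "f \<in> nsets (cell v i \<union> cell v (i + h)) 2"
    using new_edge(1)[OF x] eq by simp
  have C: "f \<subseteq> C"
    using x v_in_C cell_subset_C eq by blast
  have "A \<union> f \<in> edges H"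
    unfolding edges_switched_2_iff[OF A C] using i x eq by blast
  then show "f \<in> edges (link k H (cell v i \<union> cell v (i + h)) A)"
    using A f by (simp add: mem_link_iff Un_commute)
qed

lemma sum_star:
  assumes "c \<notin> cell v i"
  shows "(\<Sum>B\<in>{{c, b} | b. b \<in> cell v i}. \<Prod>w\<in>B. x w) = x c * cell_sum x i"
  using sum_prod_complete_bipartite[of "{c}" "cell v i" x] assms
  by (simp add: finite_cell sum_over_cell)

lemma sum_outer_parts_links:
  assumes A: "A \<in> nsets D (k - 2)" and E: "uniform_hypergraph k E"
    and cross: "\<And>B j. B \<subseteq> C \<Longrightarrow> A \<union> B \<in> edges E \<Longrightarrow> \<not> B \<subseteq> cell v j"
  shows "sum F (outer_parts (edges E) A) =
    (\<Sum>i\<in>{1..m}. \<Sum>r\<in>{1..h}. sum F (edges (link k E (cell v i \<union> cell v (i + r)) A)))"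
proof -
  have "{B \<in> outer_parts (edges E) A. B \<subseteq> cell v i \<union> cell v (i + r)} =
      edges (link k E (cell v i \<union> cell v (i + r)) A)" for i r
  proof (intro equalityI subsetI)
    fix B assume "B \<in> {B \<in> outer_parts (edges E) A. B \<subseteq> cell v i \<union> cell v (i + r)}"
    then show "B \<in> edges (link k E (cell v i \<union> cell v (i + r)) A)"
      using outer_parts_2[OF A E, of B] A
      by (auto simp: outer_parts_def mem_link_iff Un_commute nsets_def)
  next
    fix B assume "B \<in> edges (link k E (cell v i \<union> cell v (i + r)) A)"
    then have "B \<subseteq> cell v i \<union> cell v (i + r)" "A \<union> B \<in> edges E"
      using A by (auto simp: mem_link_iff Un_commute nsets_def)
    moreover from this have "B \<subseteq> C"
      using cell_subset_C by blast
    ultimately show "B \<in> {B \<in> outer_parts (edges E) A. B \<subseteq> cell v i \<union> cell v (i + r)}"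
      by (simp add: outer_parts_def)
  qed
  then show ?thesis
    using outer_parts_2[OF A E] cross
    by (subst sum_cross_pairs) (auto simp: outer_parts_def)
qed

lemma outer_sum_quadratic:
  assumes A: "A \<in> nsets D (k - 2)"
  shows "(\<Sum>B\<in>outer_parts (edges H) A. \<Prod>w\<in>B. x w) =
    (\<Sum>B\<in>outer_parts (edges G) A. \<Prod>w\<in>B. rotate_diffs 1 x w)"
proof -
  let ?Q = "rotate_diffs 1 x" and ?s = "cell_sum x"
  let ?LG = "\<lambda>i r. edges (link k G (cell v i \<union> cell v (i + r)) A)"
  let ?LH = "\<lambda>i r. edges (link k H (cell v i \<union> cell v (i + r)) A)"
  \<comment> \<open>\<open>F i\<close> is the form of the star of \<open>G\<close> centred in the
    cell \<open>i\<close> after its centre has moved by \<pi>; \<open>K i\<close> is the product of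
    sums left over from moving the centre.\<close>
  define F where "F i = x (v (centre A i - 2)) * ?s (i + h)" for i
  define K where "K i = ?s (i - 1) * ?s (i + h)" for i
  have s_shift: "?s (i + m + c) = ?s (i + c)" for i c
    using cell_sum_periodic[of x "i + c"] by (simp add: algebra_simps)
  have F_periodic: "F (i + m) = F i" for i
    using s_shift[of i h] periodic[of "centre A i - 2"]
    by (simp add: F_def centre_periodic algebra_simps)
  have K_periodic: "K (i + m) = K i" for i
    using s_shift[of i h] s_shift[of i "- 1"] by (simp add: K_def)
  have wrap: "?s (i + h + 1 + h) = ?s i" for i
    using s_shift[of i 0] m_eq by (simp add: algebra_simps)
  have near: "(\<Sum>B\<in>?LH i r. \<Prod>w\<in>B. x w) = (\<Sum>B\<in>?LG i r. \<Prod>w\<in>B. ?Q w)"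
    if r: "r \<in> {1..<h}" for i r
  proof -
    have disj: "cell v i \<inter> cell v (i + r) = {}"
      using cells_disjoint_offset r by simp
    have "(\<Sum>B\<in>{{a, b} | a b. a \<in> cell v i \<and> b \<in> cell v (i + r)}. \<Prod>w\<in>B. y w) =
        cell_sum y i * cell_sum y (i + r)" for y :: "'a \<Rightarrow> complex"
      by (simp only: sum_prod_complete_bipartite[OF finite_cell finite_cell disj] sum_over_cell)
    then show ?thesis
      using link_near[OF A, of r i] link_switched_near[OF A, of r i] r
      by (auto simp: cell_sum_rotate_diffs)
  qed
  \<comment> \<open>The star of \<open>H\<close> on the cells \<open>i\<close> and
    \<open>i + h\<close> comes from the star of \<open>G\<close> centred in the cell
    \<open>i + h + 1\<close>, hence the offset.\<close>
  have far_H: "(\<Sum>B\<in>?LH i h. \<Prod>w\<in>B. x w) = F (i + (h + 1))" if i: "i \<in> {1..m}" for i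
  proof -
    have "v (centre A (i + h + 1) - 2) \<notin> cell v i"
      using v_new_centre_in_cell[of A i] cells_disjoint_offset[of h i] h_pos by auto
    then show ?thesis
      unfolding link_switched_far[OF A i] using wrap[of i]
      by (simp add: sum_star F_def algebra_simps)
  qed
  have far_G: "(\<Sum>B\<in>?LG i h. \<Prod>w\<in>B. ?Q w) = F i + (?s i * ?s (i + h) - K i) / 2" for i
  proof -
    have "v (centre A i) \<notin> cell v (i + h)"
      using v_centre_in_cell[of A i] cells_disjoint_offset[of h i] h_pos by auto
    then show ?thesis
      unfolding link_far[OF A] rotate_diffs_shift[OF centre_cases]
      by (simp add: sum_star rotate_diffs_shift[OF centre_cases] cell_sum_rotate_diffs F_def K_def
          field_simps)
  qed
  \<comment> \<open>\<open>K\<close> pairs cells that are \<open>h + 1\<close> steps apart, which is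
    \<open>h\<close> steps the other way round; shifting by \<open>h + 1\<close> turns its sum into
    the one it has to cancel.\<close>
  have K_sum: "sum K {1..m} = (\<Sum>i\<in>{1..m}. ?s i * ?s (i + h))"
    using sum_shift[of K "h + 1", OF K_periodic] wrap
    by (simp add: K_def algebra_simps)
  have split: "{1..h} = insert h {1..<h}"
    using h_pos by auto
  have "(\<Sum>i\<in>{1..m}. \<Sum>B\<in>?LH i h. \<Prod>w\<in>B. x w) = sum F {1..m}"
    using sum_shift[of F "h + 1", OF F_periodic] by (simp add: far_H)
  also have "\<dots> = (\<Sum>i\<in>{1..m}. \<Sum>B\<in>?LG i h. \<Prod>w\<in>B. ?Q w)"
    by (simp add: far_G sum.distrib sum_subtractf sum_divide_distrib[symmetric] K_sum)
  finally have "(\<Sum>i\<in>{1..m}. \<Sum>r\<in>{1..h}. \<Sum>B\<in>?LH i r. \<Prod>w\<in>B. x w) =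
      (\<Sum>i\<in>{1..m}. \<Sum>r\<in>{1..h}. \<Sum>B\<in>?LG i r. \<Prod>w\<in>B. ?Q w)"
    unfolding split by (simp add: sum.distrib near)
  then show ?thesis
    by (simp add: sum_outer_parts_links[OF A G edge_crosses_cells[OF A]]
        sum_outer_parts_links[OF A uniform_switched switched_edge_crosses_cells[OF A]])
qed

section \<open>Traces with \<open>k - 1\<close> vertices: the linear forms\<close>

lemma outer_parts_1:
  assumes A: "A \<in> nsets D (k - 1)" and E: "uniform_hypergraph k E"
  shows "outer_parts (edges E) A = (\<lambda>w. {w}) ` {w \<in> C. {w} \<union> A \<in> edges E}"
proof (intro equalityI subsetI)
  fix B assume "B \<in> outer_parts (edges E) A"
  then have B: "B \<subseteq> C" "A \<union> B \<in> edges E"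
    by (auto simp: outer_parts_def)
  note e = uniform_hypergraph_edgeD[OF E B(2)]
  have "finite B" "A \<inter> B = {}" "finite A" "card A = k - 1"
    using e(2) A B(1) C_disjoint_D by (auto simp: nsets_def)
  then have "card B = 1"
    using e(3) k by (simp add: card_Un_disjoint)
  then obtain w where "B = {w}"
    by (rule card_1_singletonE)
  then show "B \<in> (\<lambda>w. {w}) ` {w \<in> C. {w} \<union> A \<in> edges E}"
    using B by auto
qed (auto simp: outer_parts_def)

lemma \<pi>_inj: "inj_on \<pi> C"
proof (rule inj_onI)
  fix a b assume ab: "a \<in> C" "b \<in> C" "\<pi> a = \<pi> b"
  obtain i j where "a = v i" "b = v j"
    using ab C_cases by metis
  then show "a = b"
    using ab(3) by (simp add: \<pi> v_eq_iff)
qed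

lemma neighbours_inter_C: "C \<inter> neighbours G A = {w \<in> C. {w} \<union> A \<in> edges G}"
  by (auto simp: neighbours_def verts)

text \<open>The second switching step concerns traces of size \<open>k - 2\<close>, so only the
  first can change an edge with trace \<open>A\<close>.\<close>

lemma edges_switched_1_iff:
  assumes A: "A \<in> nsets D (k - 1)" and w: "w \<in> C"
  shows "{w} \<union> A \<in> edges H \<longleftrightarrow>
    (if A \<in> one_per_cell k m v D G then w \<in> \<pi> ` (C \<inter> neighbours G A) else {w} \<union> A \<in> edges G)"
proof -
  have "A \<notin> nsets D (k - 2)"
    using A k by (auto simp: nsets_def)
  moreover have sub: "A \<subseteq> D" "{w} \<subseteq> C"
    using A w by (auto simp: nsets_def)
  ultimately show ?thesis
    unfolding Un_commute[of "{w}" A] edges_switched_iff removed1_iff[OF sub] added1_iff[OF sub]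
      removed2_iff[OF sub] added2_iff[OF sub] neighbours_inter_C
    using w by auto
qed

lemma outer_sum_linear:
  assumes A: "A \<in> nsets D (k - 1)"
  shows "(\<Sum>B\<in>outer_parts (edges H) A. \<Prod>w\<in>B. x w) =
    (\<Sum>B\<in>outer_parts (edges G) A. \<Prod>w\<in>B. rotate_diffs 1 x w)"
proof -
  let ?Q = "rotate_diffs 1 x" and ?s = "cell_sum x" and ?N = "neighbours G A"
  have singletons: "(\<Sum>B\<in>outer_parts (edges E) A. \<Prod>w\<in>B. y w) = sum y {w \<in> C. {w} \<union> A \<in> edges E}"
    if "uniform_hypergraph k E" for E and y :: "'a \<Rightarrow> complex"
    unfolding outer_parts_1[OF A that] by (subst sum.reindex) auto
  have GC: "(\<Sum>B\<in>outer_parts (edges G) A. \<Prod>w\<in>B. y w) = (\<Sum>i\<in>{1..m}. sum y (cell v i \<inter> ?N))"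
    for y :: "'a \<Rightarrow> complex"
    by (simp only: singletons[OF G] neighbours_inter_C[symmetric] sum_C_filter)
  show ?thesis
  proof (cases "A \<in> one_per_cell k m v D G")
    case True
    have "{w \<in> C. {w} \<union> A \<in> edges H} = \<pi> ` (C \<inter> ?N)"
      using edges_switched_1_iff[OF A] True \<pi>_in_C by auto
    then have "(\<Sum>B\<in>outer_parts (edges H) A. \<Prod>w\<in>B. x w) = sum x (\<pi> ` (C \<inter> ?N))"
      by (simp add: singletons[OF uniform_switched])
    also have "\<dots> = (\<Sum>i\<in>{1..m}. \<Sum>w\<in>cell v i \<inter> ?N. x (\<pi> w))"
      by (subst sum.reindex) (auto intro: inj_on_subset[OF \<pi>_inj] simp: sum_C_filter)
    \<comment> \<open>Each cell contains a single neighbour, to which the shift formula applies; the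
      corrections then telescope around the cycle.\<close>
    also have "\<dots> = (\<Sum>i\<in>{1..m}. sum ?Q (cell v i \<inter> ?N) - (?s i - ?s (i - 1)) / 2)"
    proof (intro sum.cong refl)
      fix i assume "i \<in> {1..m}"
      then have "card (cell v i \<inter> ?N) = 1"
        using True by (simp add: one_per_cell_def Int_commute)
      then obtain w where w: "cell v i \<inter> ?N = {w}"
        by (rule card_1_singletonE)
      then have "w \<in> cell v i"
        by blast
      then obtain j where j: "j \<in> {2 * i - 1, 2 * i}" "w = v j"
        by (auto simp: cell_def)
      show "(\<Sum>w\<in>cell v i \<inter> ?N. x (\<pi> w)) = sum ?Q (cell v i \<inter> ?N) - (?s i - ?s (i - 1)) / 2"
        using rotate_diffs_shift[OF j(1), of x] by (simp add: w j(2) \<pi>)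
    qed
    also have "\<dots> = (\<Sum>i\<in>{1..m}. sum ?Q (cell v i \<inter> ?N))"
      using sum_shift[of ?s "- 1", OF cell_sum_periodic]
      by (simp add: sum_subtractf sum_divide_distrib[symmetric])
    finally show ?thesis
      by (simp only: GC)
  next
    case False
    \<comment> \<open>A cell with exactly one neighbour would, by \<open>cond1\<close>, force an odd
      number and hence exactly one neighbour in every cell, putting \<open>A\<close> into
      \<open>one_per_cell\<close>.\<close>
    have even: "cell v i \<inter> ?N = {} \<or> cell v i \<inter> ?N = cell v i" if i: "i \<in> {1..m}" for i
    proof (rule ccontr)
      assume *: "\<not> (cell v i \<inter> ?N = {} \<or> cell v i \<inter> ?N = cell v i)"
      have card2: "card (cell v j) = 2" for j
        using v_Suc_neq[of j] by (simp add: cell_def)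
      have "card (cell v i \<inter> ?N) < 2" "card (cell v i \<inter> ?N) \<noteq> 0"
        using * psubset_card_mono[OF finite_cell, of "cell v i \<inter> ?N" i] card2[of i] finite_cell by auto
      then have odd: "card (?N \<inter> cell v i) mod 2 = 1"
        by (simp add: Int_commute)
      have "card (?N \<inter> cell v j) = 1" if j: "j \<in> {1..m}" for j
      proof -
        have "card (?N \<inter> cell v j) \<le> 2"
          using card_mono[OF finite_cell, of "?N \<inter> cell v j" j] card2[of j] by simp
        moreover have "card (?N \<inter> cell v j) mod 2 = 1"
          using cond1[OF A i j] odd by simp
        ultimately show ?thesis
          by (cases "card (?N \<inter> cell v j) = 2") auto
      qed
      then show False
        using False A by (simp add: one_per_cell_def)
    qed
    have "{w \<in> C. {w} \<union> A \<in> edges H} = C \<inter> ?N"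
      using edges_switched_1_iff[OF A] False neighbours_inter_C by auto
    then have "(\<Sum>B\<in>outer_parts (edges H) A. \<Prod>w\<in>B. x w) = (\<Sum>i\<in>{1..m}. sum x (cell v i \<inter> ?N))"
      by (simp only: singletons[OF uniform_switched] sum_C_filter)
    also have "\<dots> = (\<Sum>i\<in>{1..m}. sum ?Q (cell v i \<inter> ?N))"
    proof (rule sum.cong[OF refl])
      fix i assume "i \<in> {1..m}"
      from even[OF this] show "sum x (cell v i \<inter> ?N) = sum ?Q (cell v i \<inter> ?N)"
        by (auto simp: sum_over_cell cell_sum_rotate_diffs)
    qed
    finally show ?thesis
      by (simp only: GC)
  qed
qed

text \<open>At most two vertices of an edge lie outside \<open>D\<close>, so for the remaining sizes
  of \<open>A\<close> the only possible outer part is empty, with product \<open>1\<close>. This is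
  why \<open>x\<close> and \<open>y\<close> may be unrelated.\<close>

lemma outer_sum_other:
  assumes A: "A \<subseteq> D" "A \<notin> nsets D (k - 1)" "A \<notin> nsets D (k - 2)"
  shows "(\<Sum>B\<in>outer_parts (edges H) A. \<Prod>w\<in>B. x w) =
    (\<Sum>B\<in>outer_parts (edges G) A. \<Prod>w\<in>B. y w)"
proof -
  have "A \<notin> one_per_cell k m v D G"
    using A by (simp add: one_per_cell_def)
  then have eq: "outer_parts (edges H) A = outer_parts (edges G) A"
    using A by (auto simp: outer_parts_def edges_switched_iff removed1_iff added1_iff removed2_iff added2_iff)
  have "B = {}" if "B \<in> outer_parts (edges G) A" for B
  proof -
    have "B \<subseteq> C" "A \<union> B \<in> edges G"
      using that by (auto simp: outer_parts_def)
    note card = edge_cardD[OF A(1) this]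
    have "card A \<noteq> k - 1" "card A \<noteq> k - 2"
      using A card(1) by (auto simp: nsets_def)
    then have "card B = 0"
      using card by linarith
    then show ?thesis
      using card(2) by simp
  qed
  then show ?thesis
    unfolding eq by (intro sum.cong refl) force
qed

lemma edge_form_switched: "edge_form (edges H) x = edge_form (edges G) (rotate_diffs 1 x)"
proof -
  have sub: "\<Union>(edges G) \<subseteq> C \<union> D" "\<Union>(edges H) \<subseteq> C \<union> D"
    using uniform_hypergraph_edgeD(1)[OF G] uniform_hypergraph_edgeD(1)[OF uniform_switched]
    by (auto simp: verts verts_switched)
  show ?thesis
    unfolding edge_form_decompose[OF sub(1)] edge_form_decompose[OF sub(2)]
  proof (rule sum.cong[OF refl], rule arg_cong2[of _ _ _ _ "(*)"])
    fix A assume A: "A \<in> Pow D"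
    show "(\<Prod>w\<in>A. x w) = (\<Prod>w\<in>A. rotate_diffs 1 x w)"
      using A by (intro prod.cong) (auto simp: rotate_diffs_D)
    show "(\<Sum>B\<in>outer_parts (edges H) A. \<Prod>w\<in>B. x w) =
        (\<Sum>B\<in>outer_parts (edges G) A. \<Prod>w\<in>B. rotate_diffs 1 x w)"
      using A outer_sum_linear outer_sum_quadratic outer_sum_other by blast
  qed
qed

lemma E_cospectral_switched: "E_cospectral k G H"
proof (rule E_cospectral_if_orthogonal_substitution[where Q = "rotate_diffs 1" and R = "rotate_diffs (- 1)"])
  show "1 \<le> k"
    using k by simp
  show "rotate_diffs 1 (rotate_diffs (- 1) x) w = x w" "rotate_diffs (- 1) (rotate_diffs 1 x) w = x w"
    if "w \<in> verts G" for x w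
    using that rotate_diffs_inverse[of w 1 x] rotate_diffs_inverse[of w "- 1" x] by (simp_all add: verts)
qed (simp_all add: G uniform_switched verts verts_switched rotate_diffs_linear rotate_diffs_isometry
    edge_form_switched)

end

theorem corollary6p3:
  fixes m :: int and k :: nat and G :: "'a hypergraph"
    and v :: "int \<Rightarrow> 'a" and D :: "'a set" and \<pi> :: "'a \<Rightarrow> 'a"
  assumes m: "m \<ge> 3" "odd m"
    and k: "k \<ge> 2"
    and G: "uniform_hypergraph k G"
    and v_periodic: "\<And>j. v (j + 2 * m) = v j"
    and v_inj: "inj_on v {1..2 * m}"
    and verts: "verts G = (\<Union>i\<in>{1..m}. cell v i) \<union> D"
    and disjoint: "(\<Union>i\<in>{1..m}. cell v i) \<inter> D = {}"
    and \<pi>: "\<And>j. \<pi> (v j) = v (j - 2)"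
    and at_most_two: "\<And>e. e \<in> edges G \<Longrightarrow> card (e - D) \<le> 2"
    and cond1: "\<And>A i j. A \<in> nsets D (k - 1) \<Longrightarrow> i \<in> {1..m} \<Longrightarrow> j \<in> {1..m} \<Longrightarrow>
      card (neighbours G A \<inter> cell v i) mod 2 = card (neighbours G A \<inter> cell v j) mod 2"
    and cond2_near: "\<And>A i j. A \<in> nsets D (k - 2) \<Longrightarrow> i \<in> {1..m} \<Longrightarrow>
      i < j \<Longrightarrow> j < i + (m - 1) div 2 \<Longrightarrow>
      edges (link k G (cell v i \<union> cell v j) A) = {} \<or>
      edges (link k G (cell v i \<union> cell v j) A) = {{y, x} | y x. y \<in> cell v i \<and> x \<in> cell v j}"
    and cond2_far: "\<And>A i j. A \<in> nsets D (k - 2) \<Longrightarrow> i \<in> {1..m} \<Longrightarrow>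
      j = i + (m - 1) div 2 \<Longrightarrow>
      edges (link k G (cell v i \<union> cell v j) A) = {{v (2 * i - 1), x} | x. x \<in> cell v j} \<or>
      edges (link k G (cell v i \<union> cell v j) A) = {{v (2 * i), x} | x. x \<in> cell v j}"
  shows "E_cospectral k G (switched k m v D \<pi> G)"
proof -
  have "finite D"
    using G verts by (simp add: uniform_hypergraph_def)
  interpret cyclic_cells m "(m - 1) div 2" v D
  proof
    show "m = 2 * ((m - 1) div 2) + 1"
      using m(2) by presburger
    show "1 \<le> (m - 1) div 2"
      using m(1) by presburger
  qed (fact v_periodic v_inj disjoint \<open>finite D\<close>)+
  interpret cell_switching m "(m - 1) div 2" v D k G \<pi>
  proof
    show "verts G = C \<union> D"
      using verts by (simp only: C_def)
  qed (fact k G \<pi> at_most_two cond1 cond2_near cond2_far)+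
  show ?thesis
    by (rule E_cospectral_switched)
qed

end
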